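(* There exist a separable probability space $(X,\mathcal B,\mu)$, an invertible $\mu$-preserving weakly mixing transformation $T$ of $X$ and a bounded measurable function $f$ on $X$ such that the averages $$\frac 1N\sum_{n=1}^NT^{nN}f$$ do not converge in $L^2(X,\mu)$ as $N\to\infty$.
   Context: For $m\in\mathbb Z$, $T^mf(x)=f(T^mx)$. $T$ is weakly mixing if $T\times T$ is ergodic with respect to $\mu\times\mu$. *)

theory Defs
  imports "HOL-Probability.Probability"
begin

text \<open>Separability of the measure algebra with respect to the pseudometric
  \<open>d(A, B) = \<mu>(A \<triangle> B)\<close>, equivalently of the space \<open>L\<^sup>2(\<mu>)\<close>.\<close>

definition separable_prob_space :: "'a measure \<Rightarrow> bool" where
  "separable_prob_space M \<longleftrightarrow>
     prob_space M \<and>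
     (\<exists>\<C>. countable \<C> \<and> \<C> \<subseteq> sets M \<and>
        (\<forall>A\<in>sets M. \<forall>e>0. \<exists>B\<in>\<C>. measure M ((A - B) \<union> (B - A)) < e))"

definition measure_preserving_map :: "'a measure \<Rightarrow> ('a \<Rightarrow> 'a) \<Rightarrow> bool" where
  "measure_preserving_map M T \<longleftrightarrow>
     T \<in> measurable M M \<and>
     (\<forall>A\<in>sets M. emeasure M (T -` A \<inter> space M) = emeasure M A)"

definition invertible_mpt :: "'a measure \<Rightarrow> ('a \<Rightarrow> 'a) \<Rightarrow> bool" where
  "invertible_mpt M T \<longleftrightarrow>
     measure_preserving_map M T \<and>
     bij_betw T (space M) (space M) \<and>
     the_inv_into (space M) T \<in> measurable M M"

definition ergodic_map :: "'a measure \<Rightarrow> ('a \<Rightarrow> 'a) \<Rightarrow> bool" where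
  "ergodic_map M T \<longleftrightarrow>
     measure_preserving_map M T \<and>
     (\<forall>A\<in>sets M. T -` A \<inter> space M = A \<longrightarrow> measure M A = 0 \<or> measure M A = 1)"

definition weakly_mixing :: "'a measure \<Rightarrow> ('a \<Rightarrow> 'a) \<Rightarrow> bool" where
  "weakly_mixing M T \<longleftrightarrow> ergodic_map (M \<Otimes>\<^sub>M M) (map_prod T T)"

definition L2_space :: "'a measure \<Rightarrow> ('a \<Rightarrow> real) set" where
  "L2_space M = {g \<in> borel_measurable M. integrable M (\<lambda>x. (g x)\<^sup>2)}"

definition L2_norm :: "'a measure \<Rightarrow> ('a \<Rightarrow> real) \<Rightarrow> real" where
  "L2_norm M g = sqrt (\<integral>x. (g x)\<^sup>2 \<partial>M)"

text \<open>Intended for sequences in \<open>L\<^sup>2\<close>: on functions that are not square integrable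
  \<^const>\<open>L2_norm\<close> is not meaningful, as the Bochner integral is then 0.\<close>

definition converges_in_L2 :: "'a measure \<Rightarrow> (nat \<Rightarrow> 'a \<Rightarrow> real) \<Rightarrow> bool" where
  "converges_in_L2 M F \<longleftrightarrow>
     (\<exists>g\<in>L2_space M. (\<lambda>N. L2_norm M (\<lambda>x. F N x - g x)) \<longlonglongrightarrow> 0)"

definition koopman :: "('a \<Rightarrow> 'a) \<Rightarrow> nat \<Rightarrow> ('a \<Rightarrow> real) \<Rightarrow> 'a \<Rightarrow> real" where
  "koopman T m f = (\<lambda>x. f ((T ^^ m) x))"

end

theory Submission
  imports Defs
begin

text \<open>The transformation \<open>T\<close> is built so that it is almost periodic, to very high accuracy, along a
  sequence of times \<open>q\<^sub>k\<close>, and asymptotically independent of itself along another sequence \<open>m\<^sub>k\<close>.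
  If \<open>T\<^bsup>n q\<^sub>k\<^esup> f\<close> is close to \<open>f\<close> for all \<open>n \<le> q\<^sub>k\<close> at once, the averages with \<open>N = q\<^sub>k\<close> converge to
  \<open>f\<close>, so that \<open>f\<close> is the only possible limit. If it were the limit, then, for \<open>f\<close> the indicator of a
  set, \<open>f = T\<^bsup>n N\<^esup> f\<close> would hold with high probability for most \<open>n \<le> N\<close>; comparing neighbouring values of
  \<open>n\<close> gives that \<open>T\<^bsup>N\<^esup> f\<close> is close to \<open>f\<close> for every large \<open>N\<close>, which the times \<open>m\<^sub>k\<close> exclude
  (lemma \<open>rigid_mixing_not_converges\<close>). A single mixing sequence of times is also enough for weak
  mixing: approximating a \<open>T \<times> T\<close>-invariant set by cylinder sets shows that its measure is its own
  square (lemma \<open>weakly_mixingI\<close>).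

  The transformation is a limit of cyclic permutations. At stage \<open>k\<close> the unit interval is cut into \<open>q\<^sub>k\<close>
  cells of equal length which are permuted cyclically, and stage \<open>k + 1\<close> refines stage \<open>k\<close>. With
  \<open>q\<^bsub>k+1\<^esub> = q\<^sub>k\<^sup>4\<close>, the cycle of length \<open>q\<^bsub>k+1\<^esub>\<close> consists of \<open>q\<^sub>k\<close> blocks of length \<open>q\<^sub>k\<^sup>3\<close>; the \<open>i\<close>-th block runs
  \<open>q\<^sub>k\<^sup>2\<close> times through the old cycle, starting at the position \<open>i\<^sup>2\<close> mod \<open>q\<^sub>k\<close>. The blocks are so long
  that \<open>T\<^bsup>n q\<^sub>k\<^esup>\<close> for \<open>n \<le> q\<^sub>k\<close> almost never leaves one (lemma \<open>prob_rigid\<close>). A translation by the length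
  \<open>q\<^sub>k\<^sup>3\<close> of a block moves the old position by \<open>(i + 1)\<^sup>2 - i\<^sup>2 = 2 i + 1\<close>, which is uniformly distributed
  modulo the odd number \<open>q\<^sub>k\<close> and independent of the old position (lemma \<open>prob_mixing\<close>).\<close>

section \<open>Approximation by an algebra, and weak mixing\<close>

lemma (in finite_measure) abs_measure_diff_le:
  assumes "A \<in> sets M" "B \<in> sets M" "E \<in> sets M" "sym_diff A B \<subseteq> E"
  shows "\<bar>measure M A - measure M B\<bar> \<le> measure M E"
proof -
  have "measure M A \<le> measure M (B \<union> E)" "measure M B \<le> measure M (A \<union> E)"
    using assms by (intro finite_measure_mono; blast)+
  moreover have "measure M (B \<union> E) \<le> measure M B + measure M E" "measure M (A \<union> E) \<le> measure M A + measure M E"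
    using assms by (intro measure_Un_le; simp)+
  ultimately show ?thesis by linarith
qed

text \<open>The approximable sets form a \<open>\<sigma>\<close>-algebra; for a countable union, first cut off all but finitely
  many of the sets. Allowing a generator \<open>R\<close> different from \<open>G\<close> covers product measures, whose
  \<open>\<sigma>\<close>-algebra is generated by rectangles with arbitrary measurable sides.\<close>
lemma (in finite_measure) approx_by_algebra:
  assumes gen: "sets M = sigma_sets (space M) R"
    and alg: "algebra (space M) G" and G: "G \<subseteq> sets M"
    and R: "\<And>A e. A \<in> R \<Longrightarrow> 0 < e \<Longrightarrow> \<exists>B\<in>G. measure M (sym_diff A B) < e"
    and A: "A \<in> sets M" and e: "0 < e"
  shows "\<exists>B\<in>G. measure M (sym_diff A B) < e"
proof -
  interpret G: algebra "space M" G by (rule alg)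
  have "A \<in> sigma_sets (space M) R" using A gen by simp
  then show ?thesis using e
  proof (induction arbitrary: e)
    case (Basic a)
    then show ?case by (rule R)
  next
    case Empty
    then show ?case by (intro bexI[of _ "{}"]) simp_all
  next
    case (Compl a)
    obtain B where B: "B \<in> G" "measure M (sym_diff a B) < e" using Compl by blast
    have "a \<in> sets M" using Compl(1) gen by simp
    then have "sym_diff (space M - a) (space M - B) = sym_diff a B"
      using sets.sets_into_space[of a] G.sets_into_space[OF B(1)] by blast
    moreover have "space M - B \<in> G" using B(1) by (rule G.compl_sets)
    ultimately show ?case using B(2) by (intro bexI[of _ "space M - B"]) simp_all
  next
    case (Union a)
    have a: "a i \<in> sets M" for i using Union(1) gen by simp
    define U where "U n = (\<Union>i<n. a i)" for n
    have U: "U n \<in> sets M" for n using a by (auto simp: U_def)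
    have "(\<lambda>n. measure M (U n)) \<longlonglongrightarrow> measure M (\<Union>n. U n)"
    proof (rule finite_Lim_measure_incseq)
      show "incseq U" unfolding U_def by (intro monoI UN_mono) auto
    qed (use U in auto)
    moreover have "(\<Union>n. U n) = (\<Union>i. a i)" by (auto simp: U_def)
    ultimately have "(\<lambda>n. measure M (U n)) \<longlonglongrightarrow> measure M (\<Union>i. a i)" by simp
    then have "\<forall>\<^sub>F n in sequentially. measure M (U n) > measure M (\<Union>i. a i) - e / 2"
    proof (rule order_tendstoD(1))
      show "measure M (\<Union>i. a i) - e / 2 < measure M (\<Union>i. a i)" using Union(3) by linarith
    qed
    then obtain n where n: "measure M (U n) > measure M (\<Union>i. a i) - e / 2"
      unfolding eventually_sequentially by blast
    have "\<forall>i. \<exists>B\<in>G. measure M (sym_diff (a i) B) < e / (2 * (n + 1))"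
      using Union(2,3) by simp
    then obtain B where B: "\<And>i. B i \<in> G" "\<And>i. measure M (sym_diff (a i) (B i)) < e / (2 * (n + 1))"
      by metis
    have sB: "sym_diff (a i) (B i) \<in> sets M" for i
      using a[of i] B(1)[of i] G by blast
    have "measure M (sym_diff (\<Union>i. a i) (\<Union>i<n. B i)) \<le> measure M (((\<Union>i. a i) - U n) \<union> (\<Union>i<n. sym_diff (a i) (B i)))"
      using a U sB by (intro finite_measure_mono) (auto simp: U_def)
    also have "\<dots> \<le> measure M ((\<Union>i. a i) - U n) + measure M (\<Union>i<n. sym_diff (a i) (B i))"
      using a U sB by (intro measure_Un_le sets.finite_UN) auto
    also have "measure M ((\<Union>i. a i) - U n) = measure M (\<Union>i. a i) - measure M (U n)"
      using a U by (intro finite_measure_Diff) (auto simp: U_def)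
    also have "measure M (\<Union>i<n. sym_diff (a i) (B i)) \<le> (\<Sum>i<n. measure M (sym_diff (a i) (B i)))"
      using sB by (intro measure_UNION_le) auto
    also have "\<dots> \<le> (\<Sum>i<n. e / (2 * (n + 1)))"
      using B(2) by (intro sum_mono less_imp_le)
    also have "\<dots> \<le> e / 2"
      using Union(3) by (simp add: field_simps)
    finally have "measure M (sym_diff (\<Union>i. a i) (\<Union>i<n. B i)) < e" using n by linarith
    moreover have "(\<Union>i<n. B i) \<in> G" using B(1) by (intro G.finite_UN) auto
    ultimately show ?case by blast
  qed
qed

lemma funpow_measurable:
  assumes "T \<in> measurable M M" shows "T ^^ n \<in> measurable M M"
proof (induction n)
  case (Suc n)
  show ?case unfolding funpow.simps by (rule measurable_comp[OF Suc assms])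
qed (simp add: id_def)

lemma distr_funpow:
  assumes T: "T \<in> measurable M M" and distr: "distr M M T = M"
  shows "distr M M (T ^^ n) = M"
proof (induction n)
  case 0
  show ?case by (simp add: id_def distr_id)
next
  case (Suc n)
  have "distr M M (T ^^ Suc n) = distr (distr M M (T ^^ n)) M T"
    by (simp add: distr_distr[OF T funpow_measurable[OF T]])
  then show ?case using Suc distr by (simp only:)
qed

text \<open>The functions \<open>\<xi> k\<close> stand for an increasing sequence of finite partitions that generates the
  \<open>\<sigma>\<close>-algebra. Mixing of \<open>T\<close> along the times \<open>m n\<close> on their cells passes to \<open>T \<times> T\<close> on finite unions of
  products of cells. An invariant set \<open>E\<close> of \<open>T \<times> T\<close> is close to such a union \<open>B\<close>, so its measure \<open>P(E)\<close>
  is close to the measure of the intersection of \<open>B\<close> with its preimage at time \<open>m n\<close>, hence to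
  \<open>P(B)\<^sup>2\<close> and to \<open>P(E)\<^sup>2\<close>.\<close>
lemma weakly_mixingI:
  fixes T :: "'a \<Rightarrow> 'a" and \<xi> :: "nat \<Rightarrow> 'a \<Rightarrow> 'b"
  assumes "prob_space M"
    and T: "T \<in> measurable M M" and distr: "distr M M T = M"
    and gen: "sets M = sigma_sets (space M) (\<Union>k. (\<lambda>C. \<xi> k -` C \<inter> space M) ` UNIV)"
    and fin: "\<And>k. finite (\<xi> k ` space M)"
    and refine: "\<And>k l. k \<le> l \<Longrightarrow> \<exists>\<phi>. \<forall>x\<in>space M. \<xi> k x = \<phi> (\<xi> l x)"
    and mix: "\<And>k c d. (\<lambda>n. measure M (\<xi> k -` {c} \<inter> space M \<inter> ((T ^^ m n) -` (\<xi> k -` {d} \<inter> space M) \<inter> space M)))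
       \<longlonglongrightarrow> measure M (\<xi> k -` {c} \<inter> space M) * measure M (\<xi> k -` {d} \<inter> space M)"
  shows "weakly_mixing M T"
proof -
  interpret prob_space M by fact
  interpret P: pair_prob_space M M ..
  let ?P = "M \<Otimes>\<^sub>M M" and ?X = "space M" and ?S = "map_prod T T"
  define cell where "cell k c = \<xi> k -` {c} \<inter> ?X" for k c
  define box where "box k C = {z \<in> ?X \<times> ?X. map_prod (\<xi> k) (\<xi> k) z \<in> C}" for k C
  define G where "G = (\<Union>k. box k ` UNIV)"
  have \<xi>_sets: "\<xi> k -` C \<inter> ?X \<in> sets M" for k C
    unfolding gen by (intro sigma_sets.Basic) blast
  have Tn: "T ^^ n \<in> measurable M M" for n by (rule funpow_measurable[OF T])
  have Tn_sets: "(T ^^ n) -` A \<inter> ?X \<in> sets M" if "A \<in> sets M" for n A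
    by (rule measurable_sets[OF Tn that])
  have S: "?S \<in> measurable ?P ?P"
    using T unfolding map_prod_def by measurable
  have measure_Times: "measure ?P (A \<times> B) = measure M A * measure M B" if "A \<in> sets M" "B \<in> sets M" for A B
    using that by (simp add: measure_def emeasure_pair_measure_Times enn2real_mult)
  have dS: "distr ?P ?P ?S = ?P"
  proof -
    have "distr M M T \<Otimes>\<^sub>M distr M M T = distr ?P ?P (\<lambda>(x, y). (T x, T y))"
      using T by (intro pair_measure_distr) (simp_all add: distr prob_space_imp_sigma_finite prob_space_axioms)
    then show ?thesis by (simp add: distr map_prod_def)
  qed
  have Sn: "?S ^^ n = map_prod (T ^^ n) (T ^^ n)" for n
    by (induction n) (auto simp: map_prod_def fun_eq_iff)
  have presn: "measure ?P ((?S ^^ n) -` E \<inter> space ?P) = measure ?P E" if "E \<in> sets ?P" for E n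
    using measure_distr[OF funpow_measurable[OF S] that] distr_funpow[OF S dS] by simp
  \<comment> \<open>intersecting \<open>C\<close> with the attained values makes the union finite\<close>
  have box_cells: "box k C = (\<Union>(c, d)\<in>C \<inter> (\<xi> k ` ?X \<times> \<xi> k ` ?X). cell k c \<times> cell k d)" for k C
    by (auto simp: box_def cell_def)
  have cell_sets: "cell k c \<in> sets M" for k c unfolding cell_def by (rule \<xi>_sets)
  have finC: "finite (C \<inter> (\<xi> k ` ?X \<times> \<xi> k ` ?X))" for k C using fin by simp
  have box_sets: "box k C \<in> sets ?P" for k C
    unfolding box_cells using finC cell_sets by (intro sets.finite_UN) auto
  have G: "G \<subseteq> sets ?P" using box_sets by (auto simp: G_def)
  have refine2: "\<exists>D. box k C = box l D" if "k \<le> l" for k l C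
  proof -
    obtain \<phi> where "\<forall>x\<in>?X. \<xi> k x = \<phi> (\<xi> l x)" using refine[OF \<open>k \<le> l\<close>] by blast
    then have "box k C = box l {p. map_prod \<phi> \<phi> p \<in> C}" by (auto simp: box_def)
    then show ?thesis by blast
  qed
  have alg: "algebra (space ?P) G"
  proof (rule algebra_iff_Un[THEN iffD2], intro conjI ballI)
    show "G \<subseteq> Pow (space ?P)" using G sets.sets_into_space by blast
    have "{} = box 0 {}" by (simp add: box_def)
    then show "{} \<in> G" unfolding G_def by blast
  next
    fix A assume "A \<in> G"
    then obtain k C where "A = box k C" by (auto simp: G_def)
    then have "space ?P - A = box k (- C)" by (auto simp: box_def space_pair_measure)
    then show "space ?P - A \<in> G" unfolding G_def by blast
  next
    fix A B assume "A \<in> G" "B \<in> G"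
    then obtain k C l D where AB: "A = box k C" "B = box l D" by (auto simp: G_def)
    obtain C' D' where "A = box (max k l) C'" "B = box (max k l) D'"
      using refine2[of k "max k l" C] refine2[of l "max k l" D] AB by auto
    then have "A \<union> B = box (max k l) (C' \<union> D')" by (auto simp: box_def)
    then show "A \<union> B \<in> G" unfolding G_def by blast
  qed
  define G1 where "G1 = (\<Union>k. (\<lambda>C. \<xi> k -` C \<inter> ?X) ` UNIV)"
  have alg1: "algebra ?X G1"
  proof (rule algebra_iff_Un[THEN iffD2], intro conjI ballI)
    show "G1 \<subseteq> Pow ?X" by (auto simp: G1_def)
    have "{} = \<xi> 0 -` {} \<inter> ?X" by simp
    then show "{} \<in> G1" unfolding G1_def by blast
  next
    fix A assume "A \<in> G1"
    then obtain k C where "A = \<xi> k -` C \<inter> ?X" by (auto simp: G1_def)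
    then have "?X - A = \<xi> k -` (- C) \<inter> ?X" by auto
    then show "?X - A \<in> G1" unfolding G1_def by blast
  next
    fix A B assume "A \<in> G1" "B \<in> G1"
    then obtain k C l D where AB: "A = \<xi> k -` C \<inter> ?X" "B = \<xi> l -` D \<inter> ?X" by (auto simp: G1_def)
    obtain \<phi> \<psi> where "\<forall>x\<in>?X. \<xi> k x = \<phi> (\<xi> (max k l) x)" "\<forall>x\<in>?X. \<xi> l x = \<psi> (\<xi> (max k l) x)"
      using refine[of k "max k l"] refine[of l "max k l"] by auto
    then have "A \<union> B = \<xi> (max k l) -` (\<phi> -` C \<union> \<psi> -` D) \<inter> ?X" using AB by auto
    then show "A \<union> B \<in> G1" unfolding G1_def by blast
  qed
  have approx1: "\<exists>B\<in>G1. measure M (sym_diff A B) < e" if "A \<in> sets M" "0 < e" for A e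
  proof (rule approx_by_algebra[where R = G1])
    show "sets M = sigma_sets ?X G1" unfolding G1_def by (rule gen)
    show "G1 \<subseteq> sets M" using \<xi>_sets by (auto simp: G1_def)
    show "\<exists>B\<in>G1. measure M (sym_diff A B) < e" if "A \<in> G1" "0 < e" for A e
      using that by (intro bexI[of _ A]) simp_all
  qed (use alg1 that in auto)
  have rect: "\<exists>B\<in>G. measure ?P (sym_diff E B) < e"
    if rectE: "E \<in> {A \<times> B |A B. A \<in> sets M \<and> B \<in> sets M}" and e: "0 < e" for E e
  proof -
    obtain A B where E: "E = A \<times> B" "A \<in> sets M" "B \<in> sets M" using rectE by blast
    obtain A' where A': "A' \<in> G1" "measure M (sym_diff A A') < e / 2" using approx1[OF E(2), of "e / 2"] e by auto
    obtain B' where B': "B' \<in> G1" "measure M (sym_diff B B') < e / 2" using approx1[OF E(3), of "e / 2"] e by auto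
    obtain k C l D where AB: "A' = \<xi> k -` C \<inter> ?X" "B' = \<xi> l -` D \<inter> ?X" using A' B' by (auto simp: G1_def)
    obtain \<phi> \<psi> where "\<forall>x\<in>?X. \<xi> k x = \<phi> (\<xi> (max k l) x)" "\<forall>x\<in>?X. \<xi> l x = \<psi> (\<xi> (max k l) x)"
      using refine[of k "max k l"] refine[of l "max k l"] by auto
    then have "A' \<times> B' = box (max k l) ((\<phi> -` C) \<times> (\<psi> -` D))" using AB by (auto simp: box_def)
    then have inG: "A' \<times> B' \<in> G" unfolding G_def by blast
    have sA: "sym_diff A A' \<in> sets M" and sB: "sym_diff B B' \<in> sets M" using E AB \<xi>_sets by auto
    have "measure ?P (sym_diff E (A' \<times> B')) \<le> measure ?P (sym_diff A A' \<times> ?X \<union> ?X \<times> sym_diff B B')"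
      using sA sB E AB \<xi>_sets sets.sets_into_space[OF E(2)] sets.sets_into_space[OF E(3)]
      by (intro P.finite_measure_mono sets.Un pair_measureI) auto
    also have "\<dots> \<le> measure ?P (sym_diff A A' \<times> ?X) + measure ?P (?X \<times> sym_diff B B')"
      using sA sB by (intro measure_Un_le pair_measureI) auto
    also have "\<dots> = measure M (sym_diff A A') + measure M (sym_diff B B')"
      using sA sB by (simp add: measure_Times prob_space)
    finally show ?thesis using A'(2) B'(2) inG by (intro bexI[of _ "A' \<times> B'"]) linarith+
  qed
  have approx2: "\<exists>B\<in>G. measure ?P (sym_diff E B) < e" if "E \<in> sets ?P" "0 < e" for E e
    by (rule P.approx_by_algebra[where R = "{A \<times> B |A B. A \<in> sets M \<and> B \<in> sets M}"])
      (use alg G rect that in \<open>auto simp: sets_pair_measure space_pair_measure\<close>)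
  have mix2: "(\<lambda>n. measure ?P (box k C \<inter> ((?S ^^ m n) -` box k C \<inter> space ?P))) \<longlonglongrightarrow> (measure ?P (box k C))\<^sup>2" for k C
  proof -
    define F where "F = C \<inter> (\<xi> k ` ?X \<times> \<xi> k ` ?X)"
    have F: "finite F" unfolding F_def by (rule finC)
    define J where "J n c d = cell k c \<inter> ((T ^^ m n) -` cell k d \<inter> ?X)" for n c d
    have J: "J n c d \<in> sets M" for n c d
      unfolding J_def by (intro sets.Int[OF cell_sets Tn_sets[OF cell_sets]])
    have "measure ?P (box k C) = (\<Sum>p\<in>F. measure ?P (cell k (fst p) \<times> cell k (snd p)))"
    proof -
      have "box k C = (\<Union>p\<in>F. cell k (fst p) \<times> cell k (snd p))"
        unfolding box_cells F_def by auto
      then show ?thesis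
        by (simp only:) (rule P.finite_measure_finite_Union[OF F],
          auto simp: disjoint_family_on_def cell_def[of k] intro!: pair_measureI \<xi>_sets)
    qed
    also have "\<dots> = (\<Sum>p\<in>F. measure M (cell k (fst p)) * measure M (cell k (snd p)))"
      using cell_sets by (simp add: measure_Times)
    finally have bx: "measure ?P (box k C) = (\<Sum>p\<in>F. measure M (cell k (fst p)) * measure M (cell k (snd p)))" .
    have bb: "measure ?P (box k C \<inter> ((?S ^^ m n) -` box k C \<inter> space ?P))
       = (\<Sum>(p, p')\<in>F \<times> F. measure M (J n (fst p) (fst p')) * measure M (J n (snd p) (snd p')))" for n
    proof -
      define R where "R i = J n (fst (fst i)) (fst (snd i)) \<times> J n (snd (fst i)) (snd (snd i))" for i
      have "box k C \<inter> ((?S ^^ m n) -` box k C \<inter> space ?P) = (\<Union>i\<in>F \<times> F. R i)"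
      proof (intro equalityI subsetI)
        fix z assume "z \<in> box k C \<inter> ((?S ^^ m n) -` box k C \<inter> space ?P)"
        then obtain a b where z: "z = (a, b)" "a \<in> ?X" "b \<in> ?X" "(\<xi> k a, \<xi> k b) \<in> C"
          "(\<xi> k ((T ^^ m n) a), \<xi> k ((T ^^ m n) b)) \<in> C"
          by (auto simp: box_def Sn)
        define i where "i = ((\<xi> k a, \<xi> k b), (\<xi> k ((T ^^ m n) a), \<xi> k ((T ^^ m n) b)))"
        have "i \<in> F \<times> F" "z \<in> R i"
          using z measurable_space[OF Tn] by (auto simp: i_def F_def R_def J_def cell_def)
        then show "z \<in> (\<Union>i\<in>F \<times> F. R i)" by blast
      next
        fix z assume "z \<in> (\<Union>i\<in>F \<times> F. R i)"
        then show "z \<in> box k C \<inter> ((?S ^^ m n) -` box k C \<inter> space ?P)"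
          by (auto simp: box_def R_def J_def F_def cell_def Sn space_pair_measure)
      qed
      moreover have "measure ?P (\<Union>i\<in>F \<times> F. R i) = (\<Sum>i\<in>F \<times> F. measure ?P (R i))"
      proof (rule P.finite_measure_finite_Union)
        show "R ` (F \<times> F) \<subseteq> sets ?P" using J by (auto simp: R_def)
        show "disjoint_family_on R (F \<times> F)"
          by (auto simp: disjoint_family_on_def R_def J_def cell_def)
      qed (use F in simp)
      ultimately show ?thesis
        using J by (simp add: R_def measure_Times case_prod_unfold)
    qed
    have lim: "(\<lambda>n. measure M (J n c d)) \<longlonglongrightarrow> measure M (cell k c) * measure M (cell k d)" for c d
      unfolding J_def cell_def by (rule mix)
    have "(\<lambda>n. measure ?P (box k C \<inter> ((?S ^^ m n) -` box k C \<inter> space ?P)))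
       \<longlonglongrightarrow> (\<Sum>(p, p')\<in>F \<times> F. (measure M (cell k (fst p)) * measure M (cell k (fst p')))
             * (measure M (cell k (snd p)) * measure M (cell k (snd p'))))"
      unfolding bb case_prod_unfold by (intro tendsto_sum tendsto_mult lim)
    also have "(\<Sum>(p, p')\<in>F \<times> F. (measure M (cell k (fst p)) * measure M (cell k (fst p')))
             * (measure M (cell k (snd p)) * measure M (cell k (snd p')))) = (measure ?P (box k C))\<^sup>2"
      unfolding bx power2_eq_square sum_product sum.cartesian_product by (intro sum.cong) auto
    finally show ?thesis .
  qed
  have zero_one: "measure ?P E = (measure ?P E)\<^sup>2" if E: "E \<in> sets ?P" and inv: "?S -` E \<inter> space ?P = E" for E
  proof (rule ccontr)
    assume ne: "measure ?P E \<noteq> (measure ?P E)\<^sup>2"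
    \<comment> \<open>the errors below add up to \<open>4 * e\<close>, half of the assumed difference\<close>
    define e where "e = \<bar>measure ?P E - (measure ?P E)\<^sup>2\<bar> / 8"
    have e: "0 < e" using ne by (simp add: e_def)
    obtain B where B: "B \<in> G" "measure ?P (sym_diff E B) < e" using approx2[OF E e] by blast
    then obtain k C where BC: "B = box k C" by (auto simp: G_def)
    have Bs: "B \<in> sets ?P" using BC box_sets by simp
    have invn: "(?S ^^ n) -` E \<inter> space ?P = E" for n
    proof (induction n)
      case (Suc n)
      have "(?S ^^ Suc n) -` E \<inter> space ?P = ?S -` ((?S ^^ n) -` E \<inter> space ?P) \<inter> space ?P"
        using measurable_space[OF S] by (auto simp: funpow_Suc_right simp del: funpow.simps)
      then show ?case using Suc inv by (simp only:)
    qed (use sets.sets_into_space[OF E] in \<open>simp add: Int_absorb2\<close>)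
    have close: "\<bar>measure ?P E - measure ?P (B \<inter> ((?S ^^ n) -` B \<inter> space ?P))\<bar> \<le> 2 * e" for n
    proof -
      let ?D = "sym_diff E B" and ?D' = "(?S ^^ n) -` sym_diff E B \<inter> space ?P"
      have sD: "?D \<in> sets ?P" using E Bs by auto
      have sD': "?D' \<in> sets ?P" by (rule measurable_sets[OF funpow_measurable[OF S] sD])
      have sB': "(?S ^^ n) -` B \<inter> space ?P \<in> sets ?P" by (rule measurable_sets[OF funpow_measurable[OF S] Bs])
      have "\<bar>measure ?P E - measure ?P (B \<inter> ((?S ^^ n) -` B \<inter> space ?P))\<bar> \<le> measure ?P (?D \<union> ?D')"
      proof (rule P.abs_measure_diff_le)
        show "sym_diff E (B \<inter> ((?S ^^ n) -` B \<inter> space ?P)) \<subseteq> ?D \<union> ?D'"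
          using invn[of n] sets.sets_into_space[OF E] sets.sets_into_space[OF Bs] by blast
      qed (use E Bs sB' sD sD' in auto)
      also have "\<dots> \<le> measure ?P ?D + measure ?P ?D'" by (rule measure_Un_le[OF sD sD'])
      also have "measure ?P ?D' = measure ?P ?D" by (rule presn[OF sD])
      finally show ?thesis using B(2) by linarith
    qed
    have "(\<lambda>n. \<bar>measure ?P E - measure ?P (B \<inter> ((?S ^^ m n) -` B \<inter> space ?P))\<bar>) \<longlonglongrightarrow> \<bar>measure ?P E - (measure ?P B)\<^sup>2\<bar>"
      unfolding BC by (intro tendsto_intros mix2)
    then have 1: "\<bar>measure ?P E - (measure ?P B)\<^sup>2\<bar> \<le> 2 * e"
      by (rule LIMSEQ_le_const2) (use close in blast)
    have "\<bar>measure ?P E - measure ?P B\<bar> \<le> e"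
      using P.abs_measure_diff_le[OF E Bs _ order_refl] E Bs B(2) by fastforce
    moreover have "\<bar>(measure ?P E)\<^sup>2 - (measure ?P B)\<^sup>2\<bar> \<le> 2 * \<bar>measure ?P E - measure ?P B\<bar>"
    proof -
      have "(measure ?P E)\<^sup>2 - (measure ?P B)\<^sup>2 = (measure ?P E + measure ?P B) * (measure ?P E - measure ?P B)"
        by (simp add: power2_eq_square algebra_simps)
      then have "\<bar>(measure ?P E)\<^sup>2 - (measure ?P B)\<^sup>2\<bar> = (measure ?P E + measure ?P B) * \<bar>measure ?P E - measure ?P B\<bar>"
        by (simp add: abs_mult)
      also have "\<dots> \<le> 2 * \<bar>measure ?P E - measure ?P B\<bar>"
        using P.prob_le_1[of E] P.prob_le_1[of B] by (intro mult_right_mono) linarith+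
      finally show ?thesis .
    qed
    ultimately have "\<bar>measure ?P E - (measure ?P E)\<^sup>2\<bar> \<le> 4 * e" using 1 unfolding abs_le_iff by argo
    then show False using e by (simp add: e_def)
  qed
  show ?thesis
    unfolding weakly_mixing_def ergodic_map_def measure_preserving_map_def
  proof (intro conjI ballI impI S)
    show "emeasure ?P (?S -` A \<inter> space ?P) = emeasure ?P A" if "A \<in> sets ?P" for A
      using emeasure_distr[OF S that] dS by simp
    fix A assume A: "A \<in> sets ?P" "?S -` A \<inter> space ?P = A"
    show "measure ?P A = 0 \<or> measure ?P A = 1"
      using zero_one[OF A] by (simp add: power2_eq_square)
  qed
qed

section \<open>Rigidity against mixing\<close>

lemma (in prob_space) expectation_abs_le_L2_norm:
  assumes "h \<in> L2_space M"
  shows "expectation (\<lambda>x. \<bar>h x\<bar>) \<le> L2_norm M h"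
proof -
  have h: "h \<in> borel_measurable M" "integrable M (\<lambda>x. (h x)\<^sup>2)"
    using assms by (auto simp: L2_space_def)
  have "integrable M (\<lambda>x. \<bar>h x\<bar>)"
    using square_integrable_imp_integrable[OF h] by simp
  then have "variance (\<lambda>x. \<bar>h x\<bar>) = expectation (\<lambda>x. \<bar>h x\<bar>\<^sup>2) - (expectation (\<lambda>x. \<bar>h x\<bar>))\<^sup>2"
    using h by (intro variance_eq) simp_all
  then have "(expectation (\<lambda>x. \<bar>h x\<bar>))\<^sup>2 \<le> expectation (\<lambda>x. (h x)\<^sup>2)"
    using variance_positive[of "\<lambda>x. \<bar>h x\<bar>"] by simp
  then show ?thesis unfolding L2_norm_def by (rule real_le_rsqrt)
qed

text \<open>For the indicator \<open>f\<close> of a set all distances are measured by \<open>e n\<close>, the probability that \<open>f\<close> and \<open>T\<^sup>n f\<close>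
  differ. As \<open>f\<close> takes its values at the ends of \<open>[0, 1]\<close>, the \<open>L\<^sup>1\<close> distance of \<open>f\<close> from the average
  of the \<open>T\<^bsup>n N\<^esup> f\<close> equals the average of the numbers \<open>e (n * N)\<close>. Rigidity forces the limit to be \<open>f\<close>,
  so these averages vanish in the limit; by invariance of the measure
  \<open>e N \<le> e (n * N) + e ((n + 1) * N)\<close>, and averaging over \<open>n\<close> yields \<open>e N \<longlonglongrightarrow> 0\<close>. Along the mixing
  times, however, \<open>e\<close> stays away from zero.\<close>
lemma rigid_mixing_not_converges:
  assumes "prob_space M"
    and T: "T \<in> measurable M M" and distr: "distr M M T = M"
    and A: "A \<in> sets M" "0 < measure M A" "measure M A < 1"
    and rigid: "\<And>k n. n \<le> N k \<Longrightarrow> measure M {x \<in> space M. ((T ^^ (n * N k)) x \<in> A) \<noteq> (x \<in> A)} \<le> \<epsilon> k"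
    and \<epsilon>: "\<epsilon> \<longlonglongrightarrow> 0" and N: "filterlim N at_top sequentially"
    and mixing: "(\<lambda>k. measure M (A \<inter> ((T ^^ m k) -` A \<inter> space M))) \<longlonglongrightarrow> (measure M A)\<^sup>2"
    and m: "filterlim m at_top sequentially"
  shows "\<not> converges_in_L2 M (\<lambda>N x. (1 / real N) * (\<Sum>n = 1..N. koopman T (n * N) (indicator A) x))"
proof
  interpret prob_space M by fact
  let ?f = "indicator A :: 'a \<Rightarrow> real"
  define F where "F N x = (1 / real N) * (\<Sum>n = 1..N. koopman T (n * N) ?f x)" for N x
  define e where "e n = measure M {x \<in> space M. ((T ^^ n) x \<in> A) \<noteq> (x \<in> A)}" for n
  assume "converges_in_L2 M (\<lambda>N x. (1 / real N) * (\<Sum>n = 1..N. koopman T (n * N) ?f x))"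
  then obtain g where g: "g \<in> L2_space M" and lim: "(\<lambda>N. L2_norm M (\<lambda>x. F N x - g x)) \<longlonglongrightarrow> 0"
    unfolding converges_in_L2_def F_def by blast
  have Tn [measurable]: "T ^^ n \<in> measurable M M" for n by (rule funpow_measurable[OF T])
  note A(1) [measurable]
  have Tn_sets: "(T ^^ n) -` B \<inter> space M \<in> sets M" if "B \<in> sets M" for n B
    by (rule measurable_sets[OF Tn that])
  have Eset0: "{x \<in> space M. ((T ^^ n) x \<in> A) \<noteq> (x \<in> A)} \<in> sets M" for n
    by measurable
  have e_triangle: "e l \<le> e n + e (l + n)" for n l
  proof -
    have "e l = measure (distr M M (T ^^ n)) {x \<in> space M. ((T ^^ l) x \<in> A) \<noteq> (x \<in> A)}"
      by (simp add: e_def distr_funpow[OF T distr])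
    also have "\<dots> = measure M ((T ^^ n) -` {x \<in> space M. ((T ^^ l) x \<in> A) \<noteq> (x \<in> A)} \<inter> space M)"
      by (rule measure_distr[OF Tn Eset0])
    also have "\<dots> \<le> measure M ({x \<in> space M. ((T ^^ n) x \<in> A) \<noteq> (x \<in> A)} \<union> {x \<in> space M. ((T ^^ (l + n)) x \<in> A) \<noteq> (x \<in> A)})"
      by (intro finite_measure_mono sets.Un Eset0) (auto simp: funpow_add)
    also have "\<dots> \<le> e n + e (l + n)"
      unfolding e_def by (rule measure_Un_le[OF Eset0 Eset0])
    finally show ?thesis .
  qed
  have f_int: "integrable M ?f" by (intro integrable_real_indicator A(1)) (simp add: less_top[symmetric])
  have k_meas: "koopman T n ?f \<in> borel_measurable M" for n
    unfolding koopman_def by measurable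
  have F_meas: "F n \<in> borel_measurable M" for n
    unfolding F_def using k_meas by measurable
  have F_range: "\<bar>F n x\<bar> \<le> 1" for n x
  proof -
    have "(\<Sum>l = 1..n. koopman T (l * n) ?f x) \<le> (\<Sum>l = 1..n. 1)"
      by (intro sum_mono) (simp add: koopman_def indicator_def)
    moreover have "0 \<le> (\<Sum>l = 1..n. koopman T (l * n) ?f x)"
      by (intro sum_nonneg) (simp add: koopman_def)
    ultimately show ?thesis by (cases "n = 0") (simp_all add: F_def)
  qed
  have F_int: "integrable M (F n)" for n
    by (rule integrable_const_bound[where B = 1]) (use F_meas F_range in auto)
  have F_L2: "(\<lambda>x. F n x - g x) \<in> L2_space M" for n
  proof -
    have gm: "g \<in> borel_measurable M" "integrable M (\<lambda>x. (g x)\<^sup>2)" using g by (auto simp: L2_space_def)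
    have "integrable M (\<lambda>x. (F n x - g x)\<^sup>2)"
    proof (rule Bochner_Integration.integrable_bound)
      show "integrable M (\<lambda>x. 2 + 2 * (g x)\<^sup>2)" using gm by simp
      show "(\<lambda>x. (F n x - g x)\<^sup>2) \<in> borel_measurable M" using gm F_meas by measurable
      have "(F n x - g x)\<^sup>2 \<le> 2 + 2 * (g x)\<^sup>2" for x
      proof -
        have "(F n x)\<^sup>2 \<le> 1" using F_range[of n x] by (simp add: abs_square_le_1)
        moreover have "0 \<le> (F n x + g x)\<^sup>2" by simp
        ultimately show ?thesis by (simp add: power2_eq_square algebra_simps)
      qed
      then show "AE x in M. norm ((F n x - g x)\<^sup>2) \<le> norm (2 + 2 * (g x)\<^sup>2)" by simp
    qed
    then show ?thesis using gm F_meas by (simp add: L2_space_def)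
  qed
  have g_int: "integrable M g"
    using g unfolding L2_space_def by (blast intro: square_integrable_imp_integrable)
  \<comment> \<open>convergence in \<open>L\<^sup>1\<close>, where the distances between indicators are probabilities\<close>
  define D where "D n = expectation (\<lambda>x. \<bar>F n x - g x\<bar>)" for n
  have D: "D \<longlonglongrightarrow> 0"
  proof (rule tendsto_sandwich[OF _ _ tendsto_const lim])
    show "\<forall>\<^sub>F n in sequentially. 0 \<le> D n" by (simp add: D_def)
    show "\<forall>\<^sub>F n in sequentially. D n \<le> L2_norm M (\<lambda>x. F n x - g x)"
      unfolding D_def by (intro always_eventually allI expectation_abs_le_L2_norm F_L2)
  qed
  have avg: "expectation (\<lambda>x. \<bar>F n x - ?f x\<bar>) = (1 / real n) * (\<Sum>l = 1..n. e (l * n))" if n: "0 < n" for n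
  proof -
    have "\<bar>F n x - ?f x\<bar> = (1 / real n) * (\<Sum>l = 1..n. indicator {x \<in> space M. ((T ^^ (l * n)) x \<in> A) \<noteq> (x \<in> A)} x)"
      if x: "x \<in> space M" for x
    proof (cases "x \<in> A")
      case True
      have "(\<Sum>l = 1..n. indicator {x \<in> space M. ((T ^^ (l * n)) x \<in> A) \<noteq> (x \<in> A)} x)
          = (\<Sum>l = 1..n. 1 - koopman T (l * n) ?f x)"
        using True x by (intro sum.cong) (auto simp: koopman_def indicator_def)
      also have "\<dots> = n * (1 - F n x)"
        using n by (simp add: sum_subtractf F_def right_diff_distrib)
      finally show ?thesis using True n F_range[of n x] by simp
    next
      case False
      have sum: "(\<Sum>l = 1..n. indicator {x \<in> space M. ((T ^^ (l * n)) x \<in> A) \<noteq> (x \<in> A)} x)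
          = (\<Sum>l = 1..n. koopman T (l * n) ?f x)"
        using False x by (intro sum.cong) (auto simp: koopman_def indicator_def)
      have "0 \<le> F n x"
        unfolding F_def by (intro mult_nonneg_nonneg sum_nonneg) (simp_all add: koopman_def)
      then have "\<bar>F n x - ?f x\<bar> = F n x" using False by simp
      then show ?thesis by (simp only: sum F_def)
    qed
    then have "expectation (\<lambda>x. \<bar>F n x - ?f x\<bar>)
      = expectation (\<lambda>x. (1 / real n) * (\<Sum>l = 1..n. indicator {x \<in> space M. ((T ^^ (l * n)) x \<in> A) \<noteq> (x \<in> A)} x))"
      by (rule Bochner_Integration.integral_cong[OF refl])
    also have "\<dots> = (1 / real n) * (\<Sum>l = 1..n. e (l * n))"
      using Eset0 by (subst Bochner_Integration.integral_mult_right_zero, subst Bochner_Integration.integral_sum)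
        (auto simp: e_def less_top[symmetric] intro!: sum.cong)
    finally show ?thesis .
  qed
  have gf: "expectation (\<lambda>x. \<bar>g x - ?f x\<bar>) \<le> 0"
  proof (rule LIMSEQ_le_const)
    show "(\<lambda>k. D (N k) + \<epsilon> k) \<longlonglongrightarrow> 0"
      using tendsto_add[OF filterlim_compose[OF D N] \<epsilon>] by simp
    have "expectation (\<lambda>x. \<bar>g x - ?f x\<bar>) \<le> D (N k) + \<epsilon> k" if k: "0 < N k" for k
    proof -
      have "expectation (\<lambda>x. \<bar>g x - ?f x\<bar>) \<le> expectation (\<lambda>x. \<bar>F (N k) x - g x\<bar> + \<bar>F (N k) x - ?f x\<bar>)"
        using F_int g_int f_int by (intro integral_mono) auto
      also have "\<dots> = D (N k) + expectation (\<lambda>x. \<bar>F (N k) x - ?f x\<bar>)"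
        unfolding D_def using F_int g_int f_int by (intro Bochner_Integration.integral_add) auto
      also have "expectation (\<lambda>x. \<bar>F (N k) x - ?f x\<bar>) \<le> (1 / real (N k)) * (\<Sum>l = 1..N k. \<epsilon> k)"
        unfolding avg[OF k] e_def using rigid by (intro mult_left_mono sum_mono) auto
      also have "\<dots> = \<epsilon> k" using k by simp
      finally show ?thesis by simp
    qed
    moreover have "\<forall>\<^sub>F k in sequentially. 0 < N k"
      using N[unfolded filterlim_at_top, rule_format, of 1] by eventually_elim simp
    ultimately show "\<exists>K. \<forall>k\<ge>K. expectation (\<lambda>x. \<bar>g x - ?f x\<bar>) \<le> D (N k) + \<epsilon> k"
      unfolding eventually_sequentially by blast
  qed
  have e_bound: "e n \<le> 2 * D n" if n: "0 < n" for n
  proof -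
    \<comment> \<open>the summand for \<open>l = 0\<close> costs nothing, since \<open>e 0 = 0\<close>\<close>
    have "(\<Sum>l<n. e n) \<le> (\<Sum>l<n. e (l * n) + e (Suc l * n))"
      using e_triangle[of n] by (intro sum_mono) simp
    also have "\<dots> = (\<Sum>l<n. e (l * n)) + (\<Sum>l = 1..n. e (l * n))"
      by (simp only: sum.distrib sum.atLeast1_atMost_eq One_nat_def)
    also have "(\<Sum>l<n. e (l * n)) \<le> (\<Sum>l\<in>insert 0 {1..n}. e (l * n))"
      by (intro sum_mono2) (auto simp: e_def)
    also have "\<dots> = (\<Sum>l = 1..n. e (l * n))" by (simp add: e_def)
    finally have "n * e n \<le> 2 * (\<Sum>l = 1..n. e (l * n))" by simp
    also have "\<dots> = n * (2 * expectation (\<lambda>x. \<bar>F n x - ?f x\<bar>))"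
      using n by (simp add: avg[OF n])
    finally have "e n \<le> 2 * expectation (\<lambda>x. \<bar>F n x - ?f x\<bar>)"
      using n by simp
    also have "expectation (\<lambda>x. \<bar>F n x - ?f x\<bar>) \<le> expectation (\<lambda>x. \<bar>F n x - g x\<bar> + \<bar>g x - ?f x\<bar>)"
      using F_int g_int f_int by (intro integral_mono) auto
    also have "\<dots> = D n + expectation (\<lambda>x. \<bar>g x - ?f x\<bar>)"
      unfolding D_def using F_int g_int f_int by (intro Bochner_Integration.integral_add) auto
    also have "\<dots> \<le> D n" using gf by simp
    finally show ?thesis by simp
  qed
  have "measure M A - (measure M A)\<^sup>2 \<le> 0"
  proof (rule LIMSEQ_le)
    show "(\<lambda>k. measure M A - measure M (A \<inter> ((T ^^ m k) -` A \<inter> space M))) \<longlonglongrightarrow> measure M A - (measure M A)\<^sup>2"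
      by (intro tendsto_diff tendsto_const mixing)
    show "(\<lambda>k. 2 * D (m k)) \<longlonglongrightarrow> 0"
      using tendsto_mult_right_zero[OF filterlim_compose[OF D m], of 2] by simp
    have "measure M A - measure M (A \<inter> ((T ^^ n) -` A \<inter> space M)) \<le> e n" for n
    proof -
      have "measure M A - measure M (A \<inter> ((T ^^ n) -` A \<inter> space M)) = measure M (A - ((T ^^ n) -` A \<inter> space M))"
        using A(1) Tn_sets by (simp add: finite_measure_Diff')
      also have "\<dots> \<le> e n"
        unfolding e_def using sets.sets_into_space[OF A(1)] by (intro finite_measure_mono Eset0) auto
      finally show ?thesis .
    qed
    then have "measure M A - measure M (A \<inter> ((T ^^ m k) -` A \<inter> space M)) \<le> 2 * D (m k)" if "0 < m k" for k
      using e_bound[OF that] by (rule order_trans)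
    moreover have "\<forall>\<^sub>F k in sequentially. 0 < m k"
      using m[unfolded filterlim_at_top, rule_format, of 1] by eventually_elim simp
    ultimately show "\<exists>K. \<forall>k\<ge>K. measure M A - measure M (A \<inter> ((T ^^ m k) -` A \<inter> space M)) \<le> 2 * D (m k)"
      unfolding eventually_sequentially by blast
  qed
  moreover have "(measure M A)\<^sup>2 < measure M A * 1"
    unfolding power2_eq_square using A by (intro mult_strict_left_mono)
  ultimately show False by simp
qed

section \<open>The tower of cycles\<close>

text \<open>The growth \<open>q \<mapsto> q\<^sup>4\<close> leaves room for \<open>q\<close> blocks, each consisting of \<open>q\<^sup>2\<close> runs through the cycle of
  length \<open>q\<close>. The start value 3 makes every period odd.\<close>
definition period :: "nat \<Rightarrow> int" where
  "period k = 3 ^ (4 ^ k)"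

text \<open>A position \<open>j\<close> in the cycle of stage \<open>k + 1\<close> lies in the block with number \<open>j div q\<^sup>3\<close>, and that block
  starts at the position \<open>(j div q\<^sup>3)\<^sup>2\<close> of the cycle of stage \<open>k\<close>. Reducing the position within the block
  modulo \<open>q\<close> gives the same as reducing \<open>j\<close>.\<close>
definition proj :: "nat \<Rightarrow> int \<Rightarrow> int" where
  "proj k j = ((j div period k ^ 3)\<^sup>2 + j) mod period k"

lemma period_pos [simp]: "0 < period k"
  by (simp add: period_def)

lemma period_nonneg [simp]: "0 \<le> period k" and period_nonzero [simp]: "period k \<noteq> 0"
  using period_pos[of k] by linarith+

lemma period_Suc: "period (Suc k) = period k ^ 4"
  by (simp add: period_def mult.commute flip: power_mult)

lemma odd_period: "odd (period k)"
  by (simp add: period_def)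

lemma period_double: "2 * period k \<le> period (Suc k)"
proof -
  have "period k \<noteq> 1" by (simp add: period_def)
  then have two: "2 \<le> period k" using period_pos[of k] by linarith
  have "period k ^ 1 \<le> period k ^ 3"
    using two by (intro power_increasing) simp_all
  then have "period k * 2 \<le> period k * period k ^ 3"
    using two by (intro mult_left_mono) simp_all
  then show ?thesis by (simp add: period_Suc eval_nat_numeral)
qed

lemma period_gt: "int k + 2 < period k"
proof (induction k)
  case 0
  show ?case by (simp add: period_def)
next
  case (Suc k)
  then show ?case using period_double[of k] by simp
qed

lemma period_ge3: "3 \<le> period k"
  using period_gt[of k] by linarith

lemma period_dvd_Suc: "period k dvd period (Suc k)"
  by (simp add: period_Suc)

lemma cube_dvd_Suc: "period k ^ 3 dvd period (Suc k)"
  by (simp add: period_Suc le_imp_power_dvd)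

lemma mod_period_Suc_mod [simp]: "j mod period (Suc k) mod period k = j mod period k"
  by (simp add: mod_mod_cancel period_dvd_Suc)

lemma proj_range: "proj k j \<in> {0..<period k}"
  by (simp add: proj_def)

lemma div_less_of_less_mult: "a < c * b \<Longrightarrow> 0 < b \<Longrightarrow> a div b < c" for a b c :: int
  by (smt (verit) div_mult_mod_eq mult_right_mono pos_mod_sign)

lemma div_period_Suc_range:
  assumes "j \<in> {0..<period (Suc k)}"
  shows "j div period k ^ 3 \<in> {0..<period k}"
proof -
  have "j < period k * period k ^ 3"
    using assms by (simp add: period_Suc eval_nat_numeral)
  then show ?thesis using assms
    by (simp add: pos_imp_zdiv_nonneg_iff div_less_of_less_mult)
qed

lemma div_cube: "j div period k ^ 3 = j div period k div (period k)\<^sup>2"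
proof -
  have "period k ^ 3 = period k * (period k)\<^sup>2"
    by (simp add: eval_nat_numeral)
  then show ?thesis by (simp add: zdiv_zmult2_eq)
qed

lemma mod_period_Suc_div: "j mod period (Suc k) div period k ^ 3 = j div period k ^ 3 mod period k"
proof -
  have "period (Suc k) = period k ^ 3 * period k"
    by (simp add: period_Suc eval_nat_numeral)
  then show ?thesis using zmod_zmult2_eq[of "period k" j "period k ^ 3"] by simp
qed

lemma proj_mod: "proj k (j mod period (Suc k)) = proj k j"
proof -
  have "proj k (j mod period (Suc k))
      = ((j div period k ^ 3 mod period k)\<^sup>2 mod period k + j mod period (Suc k) mod period k) mod period k"
    by (simp only: proj_def mod_period_Suc_div mod_add_eq)
  also have "\<dots> = proj k j"
    by (simp only: proj_def power_mod mod_add_eq mod_period_Suc_mod)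
  finally show ?thesis .
qed

lemma proj_eqD:
  assumes "proj k j = proj k j'" and "j div period k = j' div period k"
  shows "j = j'"
proof -
  have "((j div period k ^ 3)\<^sup>2 + j) mod period k = ((j div period k ^ 3)\<^sup>2 + j') mod period k"
    using assms by (simp add: proj_def div_cube)
  then have "j mod period k = j' mod period k"
    by (simp add: mod_eq_dvd_iff)
  with assms(2) show ?thesis by (metis div_mult_mod_eq)
qed

text \<open>Inside a block the two cycles advance in parallel.\<close>
lemma proj_add:
  assumes "0 \<le> j mod period k ^ 3 + m" "j mod period k ^ 3 + m < period k ^ 3"
  shows "proj k ((j + m) mod period (Suc k)) = (proj k j + m) mod period k" 
proof -
  define i t where "i = j div period k ^ 3" and "t = j mod period k ^ 3"
  have "j + m = t + m + i * period k ^ 3"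
    using div_mult_mod_eq[of j "period k ^ 3"] by (simp only: i_def t_def)
  moreover have "(t + m) div period k ^ 3 = 0"
    using assms by (auto simp: t_def)
  ultimately have "(j + m) div period k ^ 3 = i"
    by (simp only: div_mult_self1[OF power_not_zero[OF period_nonzero]] add_0_right)
  then show ?thesis
    unfolding proj_mod by (simp only: proj_def i_def mod_add_left_eq add.assoc)
qed

text \<open>The successor of block \<open>i\<close> starts \<open>2 i + 1\<close> positions later. This also holds for the last block, since
  squares modulo \<open>q\<close> depend only on \<open>i\<close> modulo \<open>q\<close>.\<close>
lemma proj_add_cube:
  "proj k ((j + period k ^ 3) mod period (Suc k)) = (proj k j + (2 * (j div period k ^ 3) + 1)) mod period k"
proof -
  define i where "i = j div period k ^ 3"
  have "(j + period k ^ 3) div period k ^ 3 = i + 1"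
    by (simp add: i_def)
  then have "proj k (j + period k ^ 3) = ((i + 1)\<^sup>2 + j + (period k)\<^sup>2 * period k) mod period k"
    by (simp add: proj_def eval_nat_numeral algebra_simps)
  also have "\<dots> = ((i + 1)\<^sup>2 + j) mod period k"
    by (simp only: mod_mult_self1)
  also have "\<dots> = (i\<^sup>2 + j + (2 * i + 1)) mod period k"
    by (simp add: power2_eq_square algebra_simps)
  also have "\<dots> = (proj k j + (2 * i + 1)) mod period k"
    by (simp only: proj_def i_def mod_add_left_eq)
  finally show ?thesis by (simp only: proj_mod i_def)
qed

text \<open>The cell with cyclic position \<open>c\<close> of stage \<open>k\<close> is the \<open>addr k c\<close>-th interval of length \<open>1 / q\<^sub>k\<close>. Its
  \<open>q\<^sub>k\<^sup>3\<close> subintervals belong to the positions \<open>j\<close> with \<open>proj k j = c\<close>, which are told apart, and ordered,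
  by \<open>j div q\<^sub>k\<close>. This order is chosen such that stages \<open>k\<close> and \<open>k + 1\<close> usually move points by the same
  amount.\<close>
fun addr :: "nat \<Rightarrow> int \<Rightarrow> int" where
  "addr 0 c = c"
| "addr (Suc k) j = addr k (proj k j) * period k ^ 3 + j div period k"

lemma div_period_range:
  assumes "j \<in> {0..<period (Suc k)}"
  shows "j div period k \<in> {0..<period k ^ 3}"
proof -
  have "period (Suc k) = period k ^ 3 * period k"
    by (simp add: period_Suc eval_nat_numeral)
  then have "j div period k < period k ^ 3"
    using assms by (intro div_less_of_less_mult) simp_all
  moreover have "0 \<le> j div period k"
    using assms by (simp add: pos_imp_zdiv_nonneg_iff)
  ultimately show ?thesis by simp
qed

lemma addr_Suc_div:
  assumes "j \<in> {0..<period (Suc k)}"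
  shows "addr (Suc k) j div period k ^ 3 = addr k (proj k j)"
    and "addr (Suc k) j mod period k ^ 3 = j div period k"
proof -
  have d: "0 \<le> j div period k" "j div period k < period k ^ 3"
    using div_period_range[OF assms] by simp_all
  show "addr (Suc k) j div period k ^ 3 = addr k (proj k j)"
    using d unfolding addr.simps by (subst div_mult_self3) simp_all
  show "addr (Suc k) j mod period k ^ 3 = j div period k"
    using d unfolding addr.simps mod_mult_self3 by (rule mod_pos_pos_trivial)
qed

lemma addr_bij: "bij_betw (addr k) {0..<period k} {0..<period k}"
proof (induction k)
  case 0
  then show ?case by (simp add: bij_betw_def inj_on_def)
next
  case (Suc k)
  have "inj_on (addr (Suc k)) {0..<period (Suc k)}"
  proof (rule inj_onI)
    fix j j' assume j: "j \<in> {0..<period (Suc k)}" "j' \<in> {0..<period (Suc k)}"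
      and eq: "addr (Suc k) j = addr (Suc k) j'"
    have "addr k (proj k j) = addr k (proj k j')" and d: "j div period k = j' div period k"
      using addr_Suc_div[OF j(1)] addr_Suc_div[OF j(2)] eq by metis+
    then have "proj k j = proj k j'"
      using Suc proj_range by (metis bij_betw_def inj_onD)
    then show "j = j'" using d by (rule proj_eqD)
  qed
  moreover have "addr (Suc k) ` {0..<period (Suc k)} \<subseteq> {0..<period (Suc k)}"
  proof (rule image_subsetI)
    fix j assume j: "j \<in> {0..<period (Suc k)}"
    have "addr k (proj k j) \<in> {0..<period k}"
      using Suc proj_range by (metis bij_betwE)
    then have "addr k (proj k j) * period k ^ 3 \<le> (period k - 1) * period k ^ 3"
      "0 \<le> addr k (proj k j) * period k ^ 3"
      by (intro mult_right_mono mult_nonneg_nonneg; simp)+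
    moreover have "period (Suc k) = (period k - 1) * period k ^ 3 + period k ^ 3"
      by (simp add: period_Suc eval_nat_numeral algebra_simps)
    moreover have "0 \<le> j div period k" "j div period k < period k ^ 3"
      using div_period_range[OF j] by auto
    ultimately show "addr (Suc k) j \<in> {0..<period (Suc k)}"
      unfolding atLeastLessThan_iff addr.simps by linarith
  qed
  ultimately show ?case
    unfolding bij_betw_def using endo_inj_surj by blast
qed

section \<open>The probability space\<close>

definition pos :: "nat \<Rightarrow> real \<Rightarrow> int" where
  "pos k x = the_inv_into {0..<period k} (addr k) \<lfloor>of_int (period k) * x\<rfloor>"

lemma floor_range:
  assumes "x \<in> {0..<1}"
  shows "\<lfloor>of_int (period k) * x\<rfloor> \<in> {0..<period k}"
  using assms by (auto simp: floor_less_iff)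

lemma pos_range: "x \<in> {0..<1} \<Longrightarrow> pos k x \<in> {0..<period k}"
  and addr_pos: "x \<in> {0..<1} \<Longrightarrow> addr k (pos k x) = \<lfloor>of_int (period k) * x\<rfloor>"
proof -
  assume x: "x \<in> {0..<1}"
  show "pos k x \<in> {0..<period k}"
    unfolding pos_def using floor_range[OF x, of k] addr_bij[of k]
    by (metis bij_betw_def the_inv_into_into order_refl)
  show "addr k (pos k x) = \<lfloor>of_int (period k) * x\<rfloor>"
    unfolding pos_def using floor_range[OF x, of k] addr_bij[of k]
    by (metis bij_betw_def f_the_inv_into_f)
qed

lemma pos_eqI:
  assumes "x \<in> {0..<1}" "c \<in> {0..<period k}" "addr k c = \<lfloor>of_int (period k) * x\<rfloor>"
  shows "pos k x = c"
  using assms addr_bij[of k] by (metis addr_pos bij_betw_def inj_onD pos_range)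

lemma proj_pos:
  assumes x: "x \<in> {0..<1}"
  shows "proj k (pos (Suc k) x) = pos k x"
proof -
  have "\<lfloor>of_int (period (Suc k)) * x\<rfloor> div period k ^ 3
      = \<lfloor>of_int (period (Suc k)) * x / of_int (period k ^ 3)\<rfloor>"
    using floor_divide_real_eq_div[of "period k ^ 3" "of_int (period (Suc k)) * x"] by simp
  also have "of_int (period (Suc k)) * x / of_int (period k ^ 3) = of_int (period k) * x"
    by (simp add: period_Suc eval_nat_numeral)
  finally have "addr k (proj k (pos (Suc k) x)) = \<lfloor>of_int (period k) * x\<rfloor>"
    using addr_Suc_div(1)[OF pos_range[OF x, of "Suc k"]] addr_pos[OF x, of "Suc k"] by metis
  then show ?thesis
    using pos_eqI[OF x proj_range] by metis
qed

lemma card_residue_class: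
  fixes d r :: int
  assumes d: "0 < d" and S: "S \<subseteq> {0..<d}"
  shows "card {u \<in> {0..<d * r}. u mod d \<in> S} = nat r * card S"
proof -
  have dm: "(d * a + s) div d = a" "(d * a + s) mod d = s" if "s \<in> S" for a s
  proof -
    have "0 \<le> s" "s < d" using S that by auto
    then show "(d * a + s) div d = a" "(d * a + s) mod d = s"
      using int_div_pos_eq[OF refl, of s d a] int_mod_pos_eq[OF refl, of s d a] by blast+
  qed
  have "bij_betw (\<lambda>(a, s). d * a + s) ({0..<r} \<times> S) {u \<in> {0..<d * r}. u mod d \<in> S}"
  proof (rule bij_betw_byWitness[where f' = "\<lambda>u. (u div d, u mod d)"])
    show "\<forall>p\<in>{0..<r} \<times> S. ((case p of (a, s) \<Rightarrow> d * a + s) div d, (case p of (a, s) \<Rightarrow> d * a + s) mod d) = p"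
    proof
      fix p assume "p \<in> {0..<r} \<times> S"
      then show "((case p of (a, s) \<Rightarrow> d * a + s) div d, (case p of (a, s) \<Rightarrow> d * a + s) mod d) = p"
        by (cases p) (simp only: prod.case dm mem_Times_iff fst_conv snd_conv)
    qed
    show "\<forall>u\<in>{u \<in> {0..<d * r}. u mod d \<in> S}. (case (u div d, u mod d) of (a, s) \<Rightarrow> d * a + s) = u"
      by simp
    show "(\<lambda>(a, s). d * a + s) ` ({0..<r} \<times> S) \<subseteq> {u \<in> {0..<d * r}. u mod d \<in> S}"
    proof (rule image_subsetI, clarify)
      fix a s assume a: "a \<in> {0..<r}" and s: "s \<in> S"
      have "0 \<le> s" "s < d" using s S by auto
      moreover have "d * (a + 1) \<le> d * r" "0 \<le> d * a"
        using a d by (intro mult_left_mono mult_nonneg_nonneg; simp)+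
      ultimately have "d * a + s \<in> {0..<d * r}"
        unfolding atLeastLessThan_iff distrib_left by linarith
      then show "d * a + s \<in> {0..<d * r} \<and> (d * a + s) mod d \<in> S"
        using s by (simp only: dm)
    qed
    show "(\<lambda>u. (u div d, u mod d)) ` {u \<in> {0..<d * r}. u mod d \<in> S} \<subseteq> {0..<r} \<times> S"
    proof (rule image_subsetI)
      fix u assume u: "u \<in> {u \<in> {0..<d * r}. u mod d \<in> S}"
      have "u div d < r" using u d by (intro div_less_of_less_mult) (simp_all add: mult.commute)
      then show "(u div d, u mod d) \<in> {0..<r} \<times> S"
        using u d by (simp add: pos_imp_zdiv_nonneg_iff)
    qed
  qed
  then have "card {u \<in> {0..<d * r}. u mod d \<in> S} = card ({0..<r} \<times> S)"
    by (simp add: bij_betw_same_card)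
  then show ?thesis by (simp add: card_cartesian_product)
qed

definition cyl :: "nat \<Rightarrow> int set \<Rightarrow> real set" where
  "cyl k C = {x \<in> {0..<1}. pos k x \<in> C}"

definition cyls :: "real set set" where
  "cyls = (\<Union>k. cyl k ` Pow {0..<period k})"

lemma cyl_subset: "cyl k C \<subseteq> {0..<1}"
  by (auto simp: cyl_def)

lemma cyl_Int_period: "cyl k (C \<inter> {0..<period k}) = cyl k C"
  using pos_range unfolding cyl_def by blast

lemma cyl_in_cyls: "cyl k C \<in> cyls"
proof -
  have "cyl k (C \<inter> {0..<period k}) \<in> cyls"
    unfolding cyls_def by blast
  then show ?thesis unfolding cyl_Int_period .
qed

text \<open>Positions of a fine stage determine those of all coarser ones, so events of different stages can be
  compared at a common one.\<close>
lemma pos_coarsen: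
  assumes "k \<le> n"
  shows "\<exists>\<phi>. \<forall>x\<in>{0..<1}. pos k x = \<phi> (pos n x)"
  using assms
proof (induction n rule: dec_induct)
  case base
  show ?case by (rule exI[of _ id]) simp
next
  case (step n)
  then obtain \<phi> where "\<forall>x\<in>{0..<1}. pos k x = \<phi> (pos n x)" by blast
  then have "\<forall>x\<in>{0..<1}. pos k x = \<phi> (proj n (pos (Suc n) x))"
    by (metis proj_pos)
  then show ?case by (rule exI[of _ "\<lambda>u. \<phi> (proj n u)"])
qed

lemma cyl_refine:
  assumes "k \<le> n"
  shows "\<exists>C'\<subseteq>{0..<period n}. cyl k C = cyl n C'"
proof -
  obtain \<phi> where "\<forall>x\<in>{0..<1}. pos k x = \<phi> (pos n x)"
    using pos_coarsen[OF assms] by blast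
  then have "x \<in> cyl k C \<longleftrightarrow> x \<in> cyl n {u \<in> {0..<period n}. \<phi> u \<in> C}" for x
    using pos_range[of x n] unfolding cyl_def by (metis (no_types, lifting) mem_Collect_eq)
  then have "cyl k C = cyl n {u \<in> {0..<period n}. \<phi> u \<in> C}" by blast
  moreover have "{u \<in> {0..<period n}. \<phi> u \<in> C} \<subseteq> {0..<period n}" by blast
  ultimately show ?thesis by (intro exI conjI)
qed

lemma countable_cyls: "countable cyls"
  unfolding cyls_def by (intro countable_UN countableI_type countable_finite finite_imageI) auto

lemma algebra_cyls: "algebra {0..<1} cyls"
proof (rule algebra_iff_Un[THEN iffD2], intro conjI ballI)
  show "cyls \<subseteq> Pow {0..<1}" by (auto simp: cyls_def cyl_def)
  show "{} \<in> cyls" using cyl_in_cyls[of 0 "{}"] by (simp add: cyl_def)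
next
  fix A assume "A \<in> cyls"
  then obtain k C where A: "A = cyl k C" by (auto simp: cyls_def)
  have "{0..<1} - cyl k C = cyl k (- C)" by (auto simp: cyl_def)
  then show "{0..<1} - A \<in> cyls" using A cyl_in_cyls by simp
next
  fix A B assume "A \<in> cyls" "B \<in> cyls"
  then obtain k C l D where A: "A = cyl k C" and B: "B = cyl l D" by (auto simp: cyls_def)
  obtain C' where "cyl k C = cyl (max k l) C'" using cyl_refine[OF max.cobounded1] by blast
  moreover obtain D' where "cyl l D = cyl (max k l) D'" using cyl_refine[OF max.cobounded2] by blast
  moreover have "cyl (max k l) C' \<union> cyl (max k l) D' = cyl (max k l) (C' \<union> D')"
    by (auto simp: cyl_def)
  ultimately show "A \<union> B \<in> cyls" using A B cyl_in_cyls by simp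
qed

text \<open>Lebesgue measure, restricted to the \<open>\<sigma>\<close>-algebra generated by the cells; with this choice
  generation by cylinders holds by definition.\<close>
definition stack :: "real measure" where
  "stack = restr_to_subalg (restrict_space lborel {0..<1}) (sigma {0..<1} cyls)"

lemma pos_borel_measurable: "pos k \<in> borel \<rightarrow>\<^sub>M count_space UNIV"
  unfolding pos_def by measurable

lemma cyl_borel: "cyl k C \<in> sets borel"
proof -
  have "cyl k C = {0..<1} \<inter> (pos k -` C \<inter> space borel)" by (auto simp: cyl_def)
  also have "\<dots> \<in> sets borel"
    by (intro sets.Int measurable_sets[OF pos_borel_measurable]) auto
  finally show ?thesis .
qed

lemma subalgebra_cyls: "subalgebra (restrict_space lborel {0..<1}) (sigma {0..<1} cyls)"
proof -
  have "sigma_sets {0..<1} cyls \<subseteq> sets (restrict_space lborel {0..<1})"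
  proof (rule sets.sigma_sets_subset')
    show "cyls \<subseteq> sets (restrict_space lborel {0..<1})"
      using cyl_borel cyl_subset by (auto simp: cyls_def sets_restrict_space_iff)
  qed (auto simp: sets_restrict_space_iff)
  moreover have "cyls \<subseteq> Pow {0..<1}" by (auto simp: cyls_def cyl_def)
  ultimately show ?thesis
    by (simp add: subalgebra_def space_restrict_space)
qed

lemma space_stack [simp]: "space stack = {0..<1}"
  by (simp add: stack_def space_restr_to_subalg space_restrict_space)

lemma sets_stack: "sets stack = sigma_sets {0..<1} cyls"
proof -
  have "cyls \<subseteq> Pow {0..<1}" by (auto simp: cyls_def cyl_def)
  then show ?thesis by (simp add: stack_def sets_restr_to_subalg[OF subalgebra_cyls])
qed

lemma emeasure_stack: "A \<in> sets stack \<Longrightarrow> emeasure stack A = emeasure lborel A"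
  using subalgebra_cyls sets.sets_into_space[of A stack]
  by (simp add: stack_def emeasure_restr_to_subalg sets_restr_to_subalg space_restr_to_subalg
     space_restrict_space emeasure_restrict_space subset_eq)

lemma cyl_sets [measurable]: "cyl k C \<in> sets stack"
  using cyl_in_cyls by (auto simp: sets_stack)

interpretation stack: prob_space stack
  using emeasure_stack[OF sets.top] by (intro prob_spaceI) simp

lemma cyl_singleton:
  assumes "c \<in> {0..<period k}"
  shows "cyl k {c} = {of_int (addr k c) / of_int (period k)..<(of_int (addr k c) + 1) / of_int (period k)}"
proof -
  have a: "addr k c \<in> {0..<period k}" using addr_bij assms by (rule bij_betwE[THEN bspec])
  have iff: "(x \<in> {of_int (addr k c) / of_int (period k)..<(of_int (addr k c) + 1) / of_int (period k)})
     \<longleftrightarrow> \<lfloor>of_int (period k) * x\<rfloor> = addr k c" for x :: real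
    by (simp add: floor_eq_iff field_simps)
  show ?thesis
  proof (intro set_eqI iffI)
    fix x assume "x \<in> cyl k {c}"
    then show "x \<in> {of_int (addr k c) / of_int (period k)..<(of_int (addr k c) + 1) / of_int (period k)}"
      using addr_pos[of x k] unfolding iff by (auto simp: cyl_def)
  next
    fix x :: real assume x: "x \<in> {of_int (addr k c) / of_int (period k)..<(of_int (addr k c) + 1) / of_int (period k)}"
    have "0 \<le> real_of_int (addr k c) / of_int (period k)" using a by simp
    moreover have "(of_int (addr k c) + 1) / of_int (period k) \<le> (1::real)"
      using a by (simp add: divide_le_eq_1)
    ultimately have "x \<in> {0..<1}" using x unfolding atLeastLessThan_iff by linarith
    then show "x \<in> cyl k {c}"
      using x pos_eqI[OF _ assms] unfolding iff by (auto simp: cyl_def)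
  qed
qed

lemma measure_cyl:
  assumes "C \<subseteq> {0..<period k}"
  shows "measure stack (cyl k C) = card C / of_int (period k)"
proof -
  have fin: "finite C" using assms finite_subset by blast
  have 1: "measure stack (cyl k {c}) = 1 / of_int (period k)" if "c \<in> C" for c
  proof -
    have "emeasure stack (cyl k {c}) = ennreal (1 / of_int (period k))"
      using that assms by (subst emeasure_stack[OF cyl_sets], subst cyl_singleton)
        (auto simp: field_simps divide_right_mono)
    then show ?thesis by (simp add: measure_def)
  qed
  have "cyl k C = (\<Union>c\<in>C. cyl k {c})" by (auto simp: cyl_def)
  moreover have "disjoint_family_on (\<lambda>c. cyl k {c}) C"
    by (auto simp: disjoint_family_on_def cyl_def)
  moreover have "(\<lambda>c. cyl k {c}) ` C \<subseteq> sets stack" by (intro image_subsetI cyl_sets)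
  ultimately have "measure stack (cyl k C) = (\<Sum>c\<in>C. measure stack (cyl k {c}))"
    using stack.finite_measure_finite_Union[OF fin, of "\<lambda>c. cyl k {c}"] by metis
  then show ?thesis using 1 by simp
qed

lemma pos_measurable [measurable]: "pos k \<in> stack \<rightarrow>\<^sub>M count_space UNIV"
proof (rule measurableI)
  show "pos k -` A \<inter> space stack \<in> sets stack" for A
    using cyl_sets[of k A] by (simp add: cyl_def vimage_def Int_def conj_commute)
qed auto

lemma measure_pos:
  "measure stack {x \<in> {0..<1}. P (pos k x)} = card {u \<in> {0..<period k}. P u} / of_int (period k)"
proof -
  have "{x \<in> {0..<1}. P (pos k x)} = cyl k {u \<in> {0..<period k}. P u}"
    using pos_range unfolding cyl_def by blast
  then show ?thesis by (simp only:) (rule measure_cyl, blast)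
qed

lemma measure_pos_mod:
  assumes "S \<subseteq> {0..<d}" "0 < d" "d dvd period k"
  shows "measure stack {x \<in> {0..<1}. pos k x mod d \<in> S} = card S / of_int d"
proof -
  obtain r where r: "period k = d * r" using assms by blast
  then have "0 < r" using assms(2) period_pos[of k] by (metis zero_less_mult_pos)
  have "measure stack {x \<in> {0..<1}. pos k x mod d \<in> S} = (nat r * card S) / (of_int d * of_int r)"
    unfolding measure_pos[where P = "\<lambda>u. u mod d \<in> S"] r card_residue_class[OF assms(2,1)] by simp
  then show ?thesis using \<open>0 < r\<close> by simp
qed

section \<open>The limit transformation\<close>

text \<open>The \<open>m\<close>-th power of the cyclic permutation of the cells of stage \<open>k\<close>, each cell being moved by a
  translation.\<close>
definition shift :: "nat \<Rightarrow> int \<Rightarrow> real \<Rightarrow> real" where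
  "shift k m x = x + of_int (addr k ((pos k x + m) mod period k) - addr k (pos k x)) / of_int (period k)"

lemma
  assumes x: "x \<in> {0..<1}"
  shows shift_range: "shift k m x \<in> {0..<1}"
    and pos_shift: "pos k (shift k m x) = (pos k x + m) mod period k"
proof -
  define b where "b = addr k ((pos k x + m) mod period k)"
  have c: "(pos k x + m) mod period k \<in> {0..<period k}" by simp
  have b: "b \<in> {0..<period k}"
    unfolding b_def using addr_bij c by (rule bij_betwE[THEN bspec])
  have "of_int (period k) * shift k m x = of_int (period k) * x + of_int (b - addr k (pos k x))"
    by (simp add: shift_def b_def field_simps)
  then have fl: "\<lfloor>of_int (period k) * shift k m x\<rfloor> = b"
    by (simp only: floor_add_int[symmetric] addr_pos[OF x])
  then have "of_int b \<le> of_int (period k) * shift k m x" "of_int (period k) * shift k m x < of_int b + 1"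
    by linarith+
  moreover have "of_int b + 1 \<le> real_of_int (period k)" "0 \<le> real_of_int b"
    using b by auto
  ultimately have "0 \<le> of_int (period k) * shift k m x" "of_int (period k) * shift k m x < of_int (period k) * 1"
    by linarith+
  moreover have "0 < real_of_int (period k)" by simp
  ultimately have "0 \<le> shift k m x" "shift k m x < 1"
    using zero_le_mult_iff[of "real_of_int (period k)"] mult_less_cancel_left_pos by (fastforce, blast)
  then show r: "shift k m x \<in> {0..<1}" by simp
  show "pos k (shift k m x) = (pos k x + m) mod period k"
    using r c by (rule pos_eqI) (simp only: fl b_def)
qed

lemma shift_shift:
  assumes x: "x \<in> {0..<1}"
  shows "shift k m (shift k m' x) = shift k (m + m') x"
proof -
  have "((pos k x + m') mod period k + m) mod period k = (pos k x + (m + m')) mod period k"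
    by (simp only: mod_add_left_eq) (simp only: add_ac)
  then show ?thesis
    unfolding shift_def[of k m "shift k m' x"] pos_shift[OF x]
    by (simp add: shift_def add_divide_distrib diff_divide_distrib)
qed

lemma shift_0: "x \<in> {0..<1} \<Longrightarrow> shift k 0 x = x"
  using pos_range[of x k] by (simp add: shift_def)

text \<open>If \<open>m\<close> steps stay within one run through the cycle of stage \<open>k\<close>, then \<open>j div q\<close> does not change, and a
  point moves to the subinterval with the same index in its new cell: the finer translation is the
  coarser one.\<close>
lemma shift_Suc:
  assumes x: "x \<in> {0..<1}"
    and m: "0 \<le> pos (Suc k) x mod period k + m" "pos (Suc k) x mod period k + m < period k"
  shows "shift (Suc k) m x = shift k m x"
proof -
  define j where "j = pos (Suc k) x"
  define q where "q = period k"
  have q: "0 < q" by (simp add: q_def)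
  have range: "j \<in> {0..<period (Suc k)}" unfolding j_def by (rule pos_range[OF x])
  have dv: "(j + m) div q = j div q"
  proof (rule int_div_pos_eq)
    show "j + m = q * (j div q) + (j mod q + m)" by simp
  qed (use m in \<open>simp_all add: j_def q_def\<close>)
  have blk: "0 \<le> j mod q ^ 3 + m" "j mod q ^ 3 + m < q ^ 3"
  proof -
    have e: "j mod q ^ 3 = q * (j div q mod q\<^sup>2) + j mod q"
      using zmod_zmult2_eq[of "q\<^sup>2" j q] by (simp add: eval_nat_numeral)
    have "0 \<le> q * (j div q mod q\<^sup>2)" using q by simp
    then show "0 \<le> j mod q ^ 3 + m" using m(1) unfolding e j_def[symmetric] q_def[symmetric] by linarith
    have "j div q mod q\<^sup>2 < q\<^sup>2" using q by (intro pos_mod_bound) simp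
    then have "j div q mod q\<^sup>2 + 1 \<le> q\<^sup>2" by linarith
    then have "q * (j div q mod q\<^sup>2 + 1) \<le> q * q\<^sup>2" using q by (intro mult_left_mono) simp_all
    then have "q * (j div q mod q\<^sup>2) + q \<le> q ^ 3" by (simp add: eval_nat_numeral distrib_left)
    then show "j mod q ^ 3 + m < q ^ 3" using m(2) unfolding e j_def[symmetric] q_def[symmetric] by linarith
  qed
  have jm: "(j + m) mod period (Suc k) = j + m"
  proof (rule mod_pos_pos_trivial)
    have "j div q ^ 3 * q ^ 3 \<ge> 0" using q range by (simp add: pos_imp_zdiv_nonneg_iff)
    then show "0 \<le> j + m" using blk(1) div_mult_mod_eq[of j "q ^ 3"] by linarith
    have "j div q ^ 3 + 1 \<le> q" using div_period_Suc_range[OF range] by (simp add: q_def)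
    then have "(j div q ^ 3 + 1) * q ^ 3 \<le> q * q ^ 3" using q by (intro mult_right_mono) simp_all
    moreover have "q * q ^ 3 = period (Suc k)" by (simp add: q_def period_Suc eval_nat_numeral)
    ultimately show "j + m < period (Suc k)"
      using blk(2) div_mult_mod_eq[of j "q ^ 3"] by (simp only: distrib_right)
  qed
  have "proj k (j + m) = (pos k x + m) mod q"
    using proj_add[of j k m] blk jm proj_pos[OF x, of k] by (simp add: j_def q_def)
  then have "addr (Suc k) ((j + m) mod period (Suc k)) - addr (Suc k) j
     = (addr k ((pos k x + m) mod q) - addr k (pos k x)) * q ^ 3"
    using dv proj_pos[OF x, of k] jm by (simp add: q_def j_def left_diff_distrib)
  then have "shift (Suc k) m x = x + of_int ((addr k ((pos k x + m) mod q) - addr k (pos k x)) * q ^ 3) / of_int (q ^ 4)"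
    by (simp only: shift_def period_Suc j_def q_def)
  also have "\<dots> = shift k m x"
    using q by (simp add: shift_def q_def eval_nat_numeral)
  finally show ?thesis .
qed

text \<open>The points at which, for every \<open>m\<close>, the sequence \<open>shift k m x\<close> is eventually constant because
  the hypothesis of \<open>shift_Suc\<close> holds with a margin. Demanding all margins at once makes the set
  invariant.\<close>
definition regular :: "real set" where
  "regular = {x \<in> {0..<1}. \<forall>m. \<forall>\<^sub>F k in sequentially.
     m \<le> pos (Suc k) x mod period k \<and> pos (Suc k) x mod period k < period k - m}"

text \<open>All powers of the limit transformation at once. The identity on the null set of irregular points makes
  each of them a bijection of the whole interval.\<close>
definition flow :: "int \<Rightarrow> real \<Rightarrow> real" where
  "flow m x = (if x \<in> regular then THE y. \<forall>\<^sub>F k in sequentially. shift k m x = y else x)"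

lemma regular_range: "x \<in> regular \<Longrightarrow> x \<in> {0..<1}"
  by (simp add: regular_def)

lemma regularD:
  "x \<in> regular \<Longrightarrow> \<forall>\<^sub>F k in sequentially. m \<le> pos (Suc k) x mod period k \<and> pos (Suc k) x mod period k < period k - m"
  by (simp add: regular_def)

lemma flow_eq:
  assumes x: "x \<in> regular"
  shows "\<forall>\<^sub>F k in sequentially. shift k m x = flow m x"
proof -
  obtain K where K: "\<And>k. k \<ge> K \<Longrightarrow> \<bar>m\<bar> \<le> pos (Suc k) x mod period k \<and> pos (Suc k) x mod period k < period k - \<bar>m\<bar>"
    using regularD[OF x, of "\<bar>m\<bar>"] unfolding eventually_sequentially by blast
  have "shift k m x = shift K m x" if "k \<ge> K" for k
    using that
  proof (induction k rule: dec_induct)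
    case (step k)
    have "shift (Suc k) m x = shift k m x"
      using K[OF step(1)] by (intro shift_Suc regular_range[OF x]) linarith+
    then show ?case using step by simp
  qed simp
  then have ev: "\<forall>\<^sub>F k in sequentially. shift k m x = shift K m x"
    unfolding eventually_sequentially by blast
  have "(THE y. \<forall>\<^sub>F k in sequentially. shift k m x = y) = shift K m x"
  proof (rule the_equality)
    show "\<forall>\<^sub>F k in sequentially. shift k m x = shift K m x" by (rule ev)
    fix y assume "\<forall>\<^sub>F k in sequentially. shift k m x = y"
    with ev have "\<forall>\<^sub>F k::nat in sequentially. y = shift K m x" by eventually_elim simp
    then show "y = shift K m x" by simp
  qed
  with ev x show ?thesis by (simp add: flow_def)
qed

lemma flow_irregular: "x \<notin> regular \<Longrightarrow> flow m x = x"
  by (simp add: flow_def)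

lemma flow_range:
  assumes "x \<in> {0..<1}"
  shows "flow m x \<in> {0..<1}"
proof (cases "x \<in> regular")
  case True
  then obtain k where "shift k m x = flow m x"
    using flow_eq[OF True, of m] unfolding eventually_sequentially by blast
  then show ?thesis using shift_range[OF assms, of k m] by simp
qed (use assms flow_irregular in auto)

lemma pos_flow_eventually:
  assumes x: "x \<in> regular"
  shows "\<forall>\<^sub>F k in sequentially. pos k (flow m x) = (pos k x + m) mod period k"
  using flow_eq[OF x, of m] by eventually_elim (use pos_shift[OF regular_range[OF x]] in metis)

lemma flow_regular:
  assumes x: "x \<in> regular"
  shows "flow m x \<in> regular"
  unfolding regular_def
proof (intro CollectI conjI allI flow_range regular_range[OF x])
  fix m'
  have "\<forall>\<^sub>F k in sequentially. pos (Suc k) (flow m x) = (pos (Suc k) x + m) mod period (Suc k)"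
    using pos_flow_eventually[OF x, of m] by (rule eventually_sequentially_Suc[THEN iffD2])
  then show "\<forall>\<^sub>F k in sequentially. m' \<le> pos (Suc k) (flow m x) mod period k
      \<and> pos (Suc k) (flow m x) mod period k < period k - m'"
    using regularD[OF x, of "\<bar>m\<bar> + \<bar>m'\<bar>"]
  proof eventually_elim
    case (elim k)
    define p where "p = pos (Suc k) x mod period k"
    have "pos (Suc k) (flow m x) mod period k = (p + m) mod period k"
      using elim(1) by (simp add: p_def mod_add_left_eq)
    also have "\<dots> = p + m"
      using elim(2) unfolding p_def[symmetric] by (intro mod_pos_pos_trivial) linarith+
    finally show ?case using elim(2) unfolding p_def[symmetric] by linarith
  qed
qed

lemma flow_flow: "flow m (flow m' x) = flow (m + m') x"
proof (cases "x \<in> regular")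
  case True
  have "\<forall>\<^sub>F k::nat in sequentially. flow m (flow m' x) = flow (m + m') x"
    using flow_eq[OF True, of m'] flow_eq[OF True, of "m + m'"] flow_eq[OF flow_regular[OF True, of m'], of m]
  proof eventually_elim
    case (elim k)
    then show ?case using shift_shift[OF regular_range[OF True], of k m m'] by simp
  qed
  then show ?thesis by simp
qed (simp add: flow_irregular)

lemma flow_0: "x \<in> {0..<1} \<Longrightarrow> flow 0 x = x"
proof (cases "x \<in> regular")
  assume x: "x \<in> {0..<1}"
  case True
  have "\<forall>\<^sub>F k::nat in sequentially. flow 0 x = x"
    using flow_eq[OF True, of 0] by eventually_elim (simp add: shift_0[OF x])
  then show ?thesis by simp
qed (simp add: flow_irregular)

lemma funpow_flow: "x \<in> {0..<1} \<Longrightarrow> (flow 1 ^^ n) x = flow (int n) x"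
  by (induction n) (simp_all add: flow_0 flow_flow)

lemma flow_bij: "bij_betw (flow m) {0..<1} {0..<1}"
  by (rule bij_betw_byWitness[where f' = "flow (- m)"]) (auto simp: flow_flow flow_0 intro!: flow_range[simplified])

text \<open>Far out in the tower the flow adds \<open>n\<close> to the position, and this descends through every stage at which
  \<open>n\<close> steps do not leave the current block. That is much rarer than leaving a run, the event that
  governs \<open>regular\<close>; hence the strong estimate of \<open>prob_drift\<close>.\<close>
lemma pos_flow:
  assumes x: "x \<in> regular"
    and blk: "\<And>j. j \<ge> k \<Longrightarrow> pos (Suc j) x mod period j ^ 3 < period j ^ 3 - int n"
  shows "pos k (flow (int n) x) = (pos k x + int n) mod period k"
proof -
  obtain K where K: "\<And>j. j \<ge> K \<Longrightarrow> pos j (flow (int n) x) = (pos j x + int n) mod period j"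
    using pos_flow_eventually[OF x, of "int n"] unfolding eventually_sequentially by blast
  have "k \<le> max k K" by simp
  then show ?thesis
  proof (induction k rule: inc_induct)
    case base
    show ?case by (rule K) simp
  next
    case (step j)
    have "pos j (flow (int n) x) = proj j ((pos (Suc j) x + int n) mod period (Suc j))"
      using proj_pos[OF flow_range[OF regular_range[OF x]], of j] step.IH by metis
    also have "\<dots> = (proj j (pos (Suc j) x) + int n) mod period j"
      using blk[OF step(1)] by (intro proj_add) simp_all
    also have "proj j (pos (Suc j) x) = pos j x"
      by (rule proj_pos[OF regular_range[OF x]])
    finally show ?case .
  qed
qed

section \<open>Quantitative estimates\<close>

lemma period_grow: "2 ^ j * period k \<le> period (k + j)"
proof (induction j)
  case (Suc j)
  then show ?case using period_double[of "k + j"] by simp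
qed simp

lemma inverse_period_le: "1 / real_of_int (period k) \<le> (1 / 2) ^ k"
proof -
  have "2 ^ k * 1 \<le> 2 ^ k * period 0"
    by (intro mult_left_mono) (simp_all add: period_def)
  moreover have "2 ^ k * period 0 \<le> period k"
    using period_grow[of k 0] by simp
  ultimately have "2 ^ k \<le> period k" by linarith
  then have "real_of_int (2 ^ k) \<le> real_of_int (period k)" by (simp only: of_int_le_iff)
  then show ?thesis by (simp add: power_divide field_simps)
qed

lemma tendsto_over_period: "(\<lambda>k. c / real_of_int (period k)) \<longlonglongrightarrow> 0"
proof -
  have "(\<lambda>k. 1 / real_of_int (period k)) \<longlonglongrightarrow> 0"
  proof (rule tendsto_sandwich[of "\<lambda>_. 0" _ _ "\<lambda>k. (1 / 2) ^ k"])
    show "(\<lambda>k. (1 / 2 :: real) ^ k) \<longlonglongrightarrow> 0" by (rule LIMSEQ_realpow_zero) simp_all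
  qed (simp_all add: inverse_period_le less_imp_le)
  from tendsto_mult_left_zero[OF this, of c] show ?thesis by (simp add: mult.commute)
qed

lemma pos_sets: "{x \<in> {0..<1}. P (pos k x)} \<in> sets stack"
  using cyl_sets[of k "Collect P"] by (simp add: cyl_def)

lemma regular_sets [measurable]: "regular \<in> sets stack"
proof -
  have "regular = {x \<in> space stack. \<forall>m. \<exists>N. \<forall>k\<ge>N. m \<le> pos (Suc k) x mod period k \<and> pos (Suc k) x mod period k < period k - m}"
    unfolding regular_def eventually_sequentially by simp
  also have "\<dots> \<in> sets stack"
    by (intro sets.sets_Collect_countable_All sets.sets_Collect_countable_Ex sets.sets_Collect_imp
        sets.sets_Collect_const pos_sets[folded space_stack])
  finally show ?thesis .
qed

text \<open>The condition for a fixed \<open>m\<close> fails at stage \<open>k\<close> with probability at most \<open>2 \<bar>m\<bar> / q\<^sub>k\<close>, which is summable.\<close>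
lemma AE_regular: "AE x in stack. x \<in> regular"
proof -
  have "AE x in stack. \<forall>\<^sub>F k in sequentially. m \<le> pos (Suc k) x mod period k \<and> pos (Suc k) x mod period k < period k - m" for m
  proof -
    define S where "S k = {u \<in> {0..<period k}. \<not> (m \<le> u \<and> u < period k - m)}" for k
    define A where "A k = {x \<in> {0..<1}. pos (Suc k) x mod period k \<in> S k}" for k
    have "measure stack (A k) \<le> 2 * real (nat m) * (1 / 2) ^ k" for k
    proof -
      have "S k \<subseteq> {0..<m} \<union> {period k - m..<period k}" by (auto simp: S_def)
      then have "card (S k) \<le> card ({0..<m} \<union> {period k - m..<period k})" by (intro card_mono) simp_all
      also have "\<dots> \<le> 2 * nat m" by (rule order_trans[OF card_Un_le]) simp
      finally have "real (card (S k)) \<le> 2 * real (nat m)" by linarith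
      moreover have "measure stack (A k) = card (S k) * (1 / of_int (period k))"
        unfolding A_def by (subst measure_pos_mod) (auto simp: S_def period_dvd_Suc)
      ultimately show ?thesis
        using inverse_period_le[of k] by (simp only:) (intro mult_mono, simp_all)
    qed
    then have "summable (\<lambda>k. measure stack (A k))"
      by (intro summable_comparison_test[OF _ summable_mult[OF summable_geometric[of "1 / 2"]]]) auto
    then have "AE x in stack. \<forall>\<^sub>F k in sequentially. x \<in> space stack - A k"
      by (intro borel_cantelli_AE1) (auto simp: A_def less_top[symmetric] intro!: pos_sets[simplified])
    then show ?thesis
    proof eventually_elim
      case (elim x)
      then show ?case
        by eventually_elim (auto simp: A_def S_def)
    qed
  qed
  then have "AE x in stack. \<forall>m. \<forall>\<^sub>F k in sequentially. m \<le> pos (Suc k) x mod period k \<and> pos (Suc k) x mod period k < period k - m"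
    by (simp only: AE_all_countable) simp
  with AE_space show ?thesis
    by eventually_elim (simp add: regular_def)
qed

lemma measure_irregular: "measure stack ({0..<1} - regular) = 0"
proof -
  have "measure stack regular = 1"
    using AE_regular by (subst stack.prob_eq_1[OF regular_sets])
  then show ?thesis using stack.prob_compl[OF regular_sets] by simp
qed

text \<open>On regular points, membership of \<open>flow m x\<close> in a cylinder is decided by the position of \<open>x\<close> at any
  sufficiently late stage.\<close>
lemma flow_measurable [measurable]: "flow m \<in> stack \<rightarrow>\<^sub>M stack"
proof (rule measurable_sigma_sets[OF sets_stack])
  show "cyls \<subseteq> Pow {0..<1}" by (auto simp: cyls_def cyl_def)
  show "flow m \<in> space stack \<rightarrow> {0..<1}" using flow_range by auto
next
  fix A assume "A \<in> cyls"
  then obtain k C where A: "A = cyl k C" by (auto simp: cyls_def)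
  have "\<forall>n. \<exists>\<phi>. n \<ge> k \<longrightarrow> (\<forall>x\<in>{0..<1}. pos k x = \<phi> (pos n x))"
    using pos_coarsen by blast
  then obtain \<phi> where \<phi>: "\<And>n x. n \<ge> k \<Longrightarrow> x \<in> {0..<1} \<Longrightarrow> pos k x = \<phi> n (pos n x)"
    by metis
  define D where "D n = cyl n {u. \<phi> n ((u + m) mod period n) \<in> C}" for n
  have reg: "flow m x \<in> A \<longleftrightarrow> (\<exists>N. \<forall>n\<ge>N. x \<in> D n)" if x: "x \<in> regular" for x
  proof -
    have "\<forall>\<^sub>F n in sequentially. x \<in> D n \<longleftrightarrow> flow m x \<in> A"
      using flow_eq[OF x, of m] eventually_ge_at_top[of k]
    proof eventually_elim
      case (elim n)
      have "pos k (flow m x) = \<phi> n ((pos n x + m) mod period n)"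
        using \<phi>[OF elim(2) shift_range[OF regular_range[OF x], of n m]] pos_shift[OF regular_range[OF x], of n m] elim(1)
        by simp
      then show ?case
        using regular_range[OF x] flow_range[OF regular_range[OF x], of m] by (simp add: D_def A cyl_def)
    qed
    then have "(\<forall>\<^sub>F n in sequentially. x \<in> D n) \<longleftrightarrow> (\<forall>\<^sub>F n::nat in sequentially. flow m x \<in> A)"
      by (rule eventually_subst)
    also have "\<dots> \<longleftrightarrow> flow m x \<in> A" by (rule eventually_const) simp
    finally show ?thesis unfolding eventually_sequentially by (rule sym)
  qed
  have "flow m -` A \<inter> space stack = (cyl k C - regular) \<union> (regular \<inter> (\<Union>N. \<Inter>n\<in>{N..}. D n))"
    (is "?L = ?R")
  proof (intro set_eqI)
    fix x show "x \<in> ?L \<longleftrightarrow> x \<in> ?R"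
      using reg[of x] flow_irregular[of x m] regular_range[of x] cyl_subset[of k C]
      by (cases "x \<in> regular") (auto simp: A)
  qed
  also have "\<dots> \<in> sets stack"
    by (intro sets.Un sets.Diff sets.Int cyl_sets regular_sets sets.countable_UN sets.countable_INT image_subsetI)
      (auto simp: D_def)
  finally show "flow m -` A \<inter> space stack \<in> sets stack" .
qed

lemma pos_flow_sets: "{x \<in> {0..<1}. P (pos k x) (pos l (flow m x))} \<in> sets stack"
proof -
  have "{x \<in> space stack. P (pos k x) (pos l (flow m x))} \<in> sets stack" by measurable
  then show ?thesis by simp
qed

text \<open>An \<open>n\<close>-step path leaves its block of stage \<open>j\<close> with probability at most \<open>n / q\<^sub>j\<^sup>3\<close>; summing over \<open>j \<ge> k\<close>
  at most doubles the first term.\<close>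
lemma prob_drift:
  "measure stack {x \<in> {0..<1}. pos k (flow (int n) x) \<noteq> (pos k x + int n) mod period k} \<le> 2 * n / period k ^ 3"
proof -
  define S where "S j = {u \<in> {0..<period j ^ 3}. \<not> u < period j ^ 3 - int n}" for j
  define A where "A j = {x \<in> {0..<1}. pos (Suc (k + j)) x mod period (k + j) ^ 3 \<in> S (k + j)}" for j
  have bound: "measure stack (A j) \<le> n / period k ^ 3 * (1 / 2) ^ j" for j
  proof -
    let ?i = "k + j"
    have "S ?i \<subseteq> {period ?i ^ 3 - int n..<period ?i ^ 3}" by (auto simp: S_def)
    then have "card (S ?i) \<le> card {period ?i ^ 3 - int n..<period ?i ^ 3}" by (intro card_mono) simp_all
    then have "real (card (S ?i)) \<le> n" by simp
    moreover have "measure stack (A j) = card (S ?i) / of_int (period ?i ^ 3)"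
      unfolding A_def by (subst measure_pos_mod) (auto simp: S_def cube_dvd_Suc)
    ultimately have "measure stack (A j) \<le> n / of_int (period ?i ^ 3)"
      by (simp only:) (intro divide_right_mono, simp_all)
    also have "\<dots> \<le> n / (2 ^ j * of_int (period k ^ 3))"
    proof (rule divide_left_mono)
      have "period k ^ 2 \<le> period ?i ^ 2"
        using period_grow[of j k] by (intro power_mono) (auto intro: order_trans[rotated])
      then have "(2 ^ j * period k) * period k ^ 2 \<le> period ?i * period ?i ^ 2"
        using period_grow[of j k] by (intro mult_mono) simp_all
      then have "2 ^ j * period k ^ 3 \<le> period ?i ^ 3" by (simp add: eval_nat_numeral mult_ac)
      then have "real_of_int (2 ^ j * period k ^ 3) \<le> real_of_int (period ?i ^ 3)" by (simp only: of_int_le_iff)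
      then show "2 ^ j * real_of_int (period k ^ 3) \<le> real_of_int (period ?i ^ 3)" by simp
    qed simp_all
    finally show ?thesis by (simp add: power_divide field_simps)
  qed
  have sets: "A j \<in> sets stack" for j unfolding A_def by (rule pos_sets)
  have sm: "summable (\<lambda>j. n / period k ^ 3 * (1 / 2) ^ j)"
    by (intro summable_mult summable_geometric) simp
  have smA: "summable (\<lambda>j. measure stack (A j))"
    using bound by (intro summable_comparison_test[OF _ sm]) auto
  have sub: "{x \<in> {0..<1}. pos k (flow (int n) x) \<noteq> (pos k x + int n) mod period k} \<subseteq> ({0..<1} - regular) \<union> (\<Union>j. A j)"
  proof clarify
    fix x :: real assume x: "x \<in> {0..<1}" and ne: "pos k (flow (int n) x) \<noteq> (pos k x + int n) mod period k"
      and A: "x \<notin> (\<Union>j. A j)" and r: "x \<in> regular"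
    have "pos (Suc j) x mod period j ^ 3 < period j ^ 3 - int n" if "j \<ge> k" for j
    proof -
      have "x \<notin> A (j - k)" using A by blast
      then show ?thesis using that x by (auto simp: A_def S_def)
    qed
    then show False using pos_flow[OF r] ne by blast
  qed
  have "measure stack {x \<in> {0..<1}. pos k (flow (int n) x) \<noteq> (pos k x + int n) mod period k}
      \<le> measure stack (({0..<1} - regular) \<union> (\<Union>j. A j))"
    by (intro stack.finite_measure_mono[OF sub] sets.Un sets.countable_UN)
      (use sets sets.Diff[OF sets.top regular_sets] in auto)
  also have "\<dots> \<le> measure stack ({0..<1} - regular) + measure stack (\<Union>j. A j)"
    by (intro measure_Un_le sets.countable_UN)
      (use sets sets.Diff[OF sets.top regular_sets] in auto)
  also have "\<dots> \<le> (\<Sum>j. measure stack (A j))"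
    unfolding measure_irregular using sets smA
    by (simp only: add_0) (intro stack.finite_measure_subadditive_countably, auto)
  also have "\<dots> \<le> (\<Sum>j. n / period k ^ 3 * (1 / 2) ^ j)"
    by (intro suminf_le bound smA sm)
  also have "\<dots> = 2 * n / period k ^ 3"
    by (subst suminf_mult) (simp_all add: suminf_geometric)
  finally show ?thesis by (simp only: of_nat_mult of_nat_numeral)
qed

lemma prob_rigid:
  assumes "n \<le> nat (period k)"
  shows "measure stack {x \<in> {0..<1}. pos k (flow (int n * period k) x) \<noteq> pos k x} \<le> 2 / period k"
proof -
  let ?q = "period k"
  have q: "0 < real_of_int ?q" by simp
  have N: "int n * ?q = int (n * nat ?q)" by simp
  have "{x \<in> {0..<1}. pos k (flow (int n * ?q) x) \<noteq> pos k x}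
     = {x \<in> {0..<1}. pos k (flow (int (n * nat ?q)) x) \<noteq> (pos k x + int (n * nat ?q)) mod ?q}"
    unfolding N[symmetric] using pos_range[of _ k] by auto
  then have "measure stack {x \<in> {0..<1}. pos k (flow (int n * ?q) x) \<noteq> pos k x} \<le> 2 * (n * nat ?q) / ?q ^ 3"
    using prob_drift[of k "n * nat ?q"] by simp
  also have "\<dots> \<le> 2 * (?q * ?q) / ?q ^ 3"
  proof -
    have "int n \<le> ?q" using assms by (simp add: le_nat_iff)
    then have "real n \<le> of_int ?q" by linarith
    then have "real (n * nat ?q) \<le> of_int ?q * of_int ?q" by (simp add: mult_right_mono)
    then show ?thesis by (intro divide_right_mono) simp_all
  qed
  also have "\<dots> = 2 / ?q" using q by (simp add: eval_nat_numeral)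
  finally show ?thesis by simp
qed

lemma card_rotate:
  assumes "C \<subseteq> {0..<q :: int}" "0 < q"
  shows "card {u \<in> {0..<q}. (u + n) mod q \<in> C} = card C"
proof -
  have "bij_betw (\<lambda>u. (u + n) mod q) {u \<in> {0..<q}. (u + n) mod q \<in> C} C"
  proof (rule bij_betw_byWitness[where f' = "\<lambda>v. (v - n) mod q"])
    show "\<forall>u\<in>{u \<in> {0..<q}. (u + n) mod q \<in> C}. ((u + n) mod q - n) mod q = u"
      by (auto simp: mod_diff_left_eq)
    have "((v - n) mod q + n) mod q = v" if "v \<in> C" for v
    proof -
      have "((v - n) mod q + n) mod q = v mod q" by (simp add: mod_add_left_eq)
      also have "\<dots> = v" using that assms by (intro mod_pos_pos_trivial) auto
      finally show ?thesis .
    qed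
    then show "\<forall>v\<in>C. ((v - n) mod q + n) mod q = v"
      and "(\<lambda>v. (v - n) mod q) ` C \<subseteq> {u \<in> {0..<q}. (u + n) mod q \<in> C}"
      using assms by auto
  qed auto
  then show ?thesis by (rule bij_betw_same_card)
qed

text \<open>A rotation of the cycle of stage \<open>j\<close> preserves the measure, and the flow differs from it by an error
  that vanishes as \<open>j\<close> grows.\<close>
lemma measure_flow_cyl:
  assumes C: "C \<subseteq> {0..<period k}"
  shows "measure stack (flow (int n) -` cyl k C \<inter> space stack) = measure stack (cyl k C)"
proof -
  let ?L = "flow (int n) -` cyl k C \<inter> space stack"
  have bound: "\<bar>measure stack ?L - measure stack (cyl k C)\<bar> \<le> 2 * real n / period j" if j: "k \<le> j" for j
  proof -
    obtain D where D: "D \<subseteq> {0..<period j}" "cyl k C = cyl j D"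
      using cyl_refine[OF j, of C] by blast
    define E where "E = {x \<in> {0..<1}. (pos j x + int n) mod period j \<in> D}"
    define B where "B = {x \<in> {0..<1}. pos j (flow (int n) x) \<noteq> (pos j x + int n) mod period j}"
    have "measure stack E = measure stack (cyl k C)"
      unfolding E_def D(2) measure_cyl[OF D(1)] measure_pos[where P = "\<lambda>u. (u + int n) mod period j \<in> D"]
      by (simp only: card_rotate[OF D(1) period_pos])
    moreover have "\<bar>measure stack ?L - measure stack E\<bar> \<le> measure stack B"
    proof (rule stack.abs_measure_diff_le)
      show "?L \<in> sets stack" by (rule measurable_sets[OF flow_measurable cyl_sets])
      show "E \<in> sets stack" unfolding E_def by (rule pos_sets)
      show "B \<in> sets stack" unfolding B_def by (rule pos_flow_sets)
      show "sym_diff ?L E \<subseteq> B"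
        unfolding D(2) using flow_range by (auto simp: E_def B_def cyl_def)
    qed
    moreover have "measure stack B \<le> 2 * real n / period j ^ 3"
      unfolding B_def by (rule prob_drift)
    moreover have "2 * real n / period j ^ 3 \<le> 2 * real n / period j"
    proof (rule divide_left_mono)
      have "period j ^ 1 \<le> period j ^ 3" using period_ge3[of j] by (intro power_increasing) simp_all
      then show "real_of_int (period j) \<le> real_of_int (period j ^ 3)" by (simp only: of_int_le_iff power_one_right)
    qed simp_all
    ultimately show ?thesis by linarith
  qed
  have "\<bar>measure stack ?L - measure stack (cyl k C)\<bar> \<le> 0"
  proof (rule LIMSEQ_le_const[OF tendsto_over_period[of "2 * real n"]])
    show "\<exists>N. \<forall>j\<ge>N. \<bar>measure stack ?L - measure stack (cyl k C)\<bar> \<le> 2 * real n / real_of_int (period j)"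
      using bound by blast
  qed
  then show ?thesis by simp
qed

lemma distr_flow: "distr stack stack (flow (int n)) = stack"
proof (rule measure_eqI_generator_eq[where E = cyls and \<Omega> = "{0..<1}" and A = "\<lambda>_. {0..<1}"])
  show "Int_stable cyls"
    using algebra_cyls by (auto simp: Int_stable_def algebra_iff_Int)
  show "cyls \<subseteq> Pow {0..<1}" by (auto simp: cyls_def cyl_def)
  show "range (\<lambda>_. {0..<1}) \<subseteq> cyls"
  proof -
    have "{0..<1} = cyl 0 UNIV" by (auto simp: cyl_def)
    then show ?thesis using cyl_in_cyls[of 0 UNIV] by auto
  qed
  show "emeasure (distr stack stack (flow (int n))) A = emeasure stack A" if in_cyls: "A \<in> cyls" for A
  proof -
    obtain k C where A: "A = cyl k C" "C \<subseteq> {0..<period k}" using in_cyls unfolding cyls_def by blast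
    then show ?thesis
      using measure_flow_cyl[OF A(2), of n]
      by (simp add: emeasure_distr stack.emeasure_eq_measure)
  qed
next
  show "emeasure (distr stack stack (flow (int n))) {0..<1} \<noteq> \<infinity>"
    using measurable_space[OF flow_measurable] by (subst emeasure_distr) (simp_all add: sets_stack sigma_sets_top)
qed (simp_all add: sets_stack)

text \<open>A position \<open>u\<close> is determined by its projection, the projection of its translate by one block, and the
  index of its run within its block: the difference of the projections is \<open>2 i + 1\<close>, which gives the
  block \<open>i\<close> because the period is odd. Counting shows that every such triple occurs, so the two
  projections are independent and uniform.\<close>
lemma card_proj_shift_pair:
  assumes C: "C \<subseteq> {0..<period k}" and D: "D \<subseteq> {0..<period k}"
  shows "card {u \<in> {0..<period (Suc k)}. proj k u \<in> C \<and> proj k ((u + period k ^ 3) mod period (Suc k)) \<in> D}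
    = card C * card D * nat ((period k)\<^sup>2)"
proof -
  define q where "q = period k"
  have q: "0 < q" by (simp add: q_def)
  define g where "g u = (proj k u, proj k ((u + q ^ 3) mod period (Suc k)), u div q mod q\<^sup>2)" for u
  have inj: "inj_on g {0..<period (Suc k)}"
  proof (rule inj_onI)
    fix u v assume u: "u \<in> {0..<period (Suc k)}" and v: "v \<in> {0..<period (Suc k)}" and "g u = g v"
    then have p: "proj k u = proj k v" and b: "u div q mod q\<^sup>2 = v div q mod q\<^sup>2"
      and s: "(proj k u + (2 * (u div q ^ 3) + 1)) mod q = (proj k u + (2 * (v div q ^ 3) + 1)) mod q"
      by (auto simp only: g_def prod.inject proj_add_cube q_def)
    have "q dvd 2 * (u div q ^ 3 - v div q ^ 3)"
      using s by (simp add: mod_eq_dvd_iff algebra_simps)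
    moreover have "coprime q 2"
      using odd_period[of k] by (simp add: q_def)
    ultimately have "q dvd u div q ^ 3 - v div q ^ 3"
      by (simp only: coprime_dvd_mult_right_iff)
    then have "u div q ^ 3 mod q = v div q ^ 3 mod q"
      by (simp only: mod_eq_dvd_iff)
    then have "u div q ^ 3 = v div q ^ 3"
      using div_period_Suc_range[OF u] div_period_Suc_range[OF v] by (simp add: q_def)
    then have "u div q div q\<^sup>2 = v div q div q\<^sup>2" by (simp only: div_cube q_def)
    then have "u div q = v div q"
      using b by (metis div_mult_mod_eq)
    then show "u = v" unfolding q_def by (rule proj_eqD[OF p])
  qed
  have "g ` {0..<period (Suc k)} = {0..<q} \<times> {0..<q} \<times> {0..<q\<^sup>2}"
  proof (rule card_subset_eq)
    show "g ` {0..<period (Suc k)} \<subseteq> {0..<q} \<times> {0..<q} \<times> {0..<q\<^sup>2}"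
      using proj_range q by (auto simp: g_def q_def)
    have "card ({0..<q} \<times> {0..<q} \<times> {0..<q\<^sup>2}) = nat q * (nat q * nat (q\<^sup>2))"
      by (simp add: card_cartesian_product)
    also have "\<dots> = nat (period (Suc k))"
      using q by (simp add: period_Suc eval_nat_numeral nat_mult_distrib flip: q_def)
    also have "\<dots> = card (g ` {0..<period (Suc k)})"
      by (simp add: card_image[OF inj])
    finally show "card (g ` {0..<period (Suc k)}) = card ({0..<q} \<times> {0..<q} \<times> {0..<q\<^sup>2})" by (rule sym)
  qed simp
  then have bij: "bij_betw g {0..<period (Suc k)} ({0..<q} \<times> {0..<q} \<times> {0..<q\<^sup>2})"
    using inj by (simp only: bij_betw_def)
  define W where "W = {u \<in> {0..<period (Suc k)}. proj k u \<in> C \<and> proj k ((u + q ^ 3) mod period (Suc k)) \<in> D}"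
  have W: "W = {u \<in> {0..<period (Suc k)}. g u \<in> C \<times> D \<times> {0..<q\<^sup>2}}"
    using q by (auto simp: g_def W_def)
  have "C \<times> D \<times> {0..<q\<^sup>2} \<subseteq> g ` {0..<period (Suc k)}"
    using bij C D by (auto simp: bij_betw_def q_def)
  moreover have "g ` {u \<in> S. g u \<in> T} = T" if "T \<subseteq> g ` S" for S T
    using that by blast
  ultimately have "g ` W = C \<times> D \<times> {0..<q\<^sup>2}" unfolding W by (simp only:)
  moreover have "inj_on g W" using inj by (rule inj_on_subset) (unfold W_def, blast)
  then have "card (g ` W) = card W" by (rule card_image)
  ultimately have "card W = card (C \<times> D \<times> {0..<q\<^sup>2})" by simp
  then show ?thesis by (simp add: W_def q_def card_cartesian_product)
qed

text \<open>The translation time of one block of stage \<open>k\<close> is negligible against the blocks of stage \<open>k + 1\<close>, so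
  by \<open>prob_drift\<close> the flow adds it to the position of stage \<open>k + 1\<close>, up to a small probability.\<close>
lemma prob_mixing:
  assumes C: "C \<subseteq> {0..<period k}" and D: "D \<subseteq> {0..<period k}"
  shows "\<bar>measure stack (cyl k C \<inter> (flow (period k ^ 3) -` cyl k D \<inter> space stack))
            - measure stack (cyl k C) * measure stack (cyl k D)\<bar> \<le> 2 / period k"
proof -
  let ?q = "period k" and ?q' = "period (Suc k)"
  define N where "N = nat (?q ^ 3)"
  have N: "int N = ?q ^ 3" by (simp add: N_def)
  let ?L = "cyl k C \<inter> (flow (int N) -` cyl k D \<inter> space stack)"
  define E where "E = {x \<in> {0..<1}. proj k (pos (Suc k) x) \<in> C \<and> proj k ((pos (Suc k) x + int N) mod ?q') \<in> D}"
  define B where "B = {x \<in> {0..<1}. pos (Suc k) (flow (int N) x) \<noteq> (pos (Suc k) x + int N) mod ?q'}"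
  have "measure stack E = card {u \<in> {0..<?q'}. proj k u \<in> C \<and> proj k ((u + int N) mod ?q') \<in> D} / of_int ?q'"
    unfolding E_def by (rule measure_pos)
  also have "\<dots> = card C * card D * nat (?q\<^sup>2) / of_int ?q'"
    unfolding N card_proj_shift_pair[OF assms] by simp
  also have "\<dots> = measure stack (cyl k C) * measure stack (cyl k D)"
    unfolding measure_cyl[OF C] measure_cyl[OF D] by (simp add: period_Suc eval_nat_numeral)
  finally have E: "measure stack E = measure stack (cyl k C) * measure stack (cyl k D)" .
  have "\<bar>measure stack ?L - measure stack E\<bar> \<le> measure stack B"
  proof (rule stack.abs_measure_diff_le)
    show "?L \<in> sets stack" by (intro sets.Int cyl_sets measurable_sets[OF flow_measurable cyl_sets])
    show "E \<in> sets stack" unfolding E_def by (rule pos_sets)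
    show "B \<in> sets stack" unfolding B_def by (rule pos_flow_sets)
    show "sym_diff ?L E \<subseteq> B"
    proof
      fix x assume x: "x \<in> sym_diff ?L E"
      then have x01: "x \<in> {0..<1}" by (auto simp: E_def cyl_def)
      have "proj k (pos (Suc k) x) = pos k x" 
        "proj k (pos (Suc k) (flow (int N) x)) = pos k (flow (int N) x)"
        using proj_pos[OF x01] proj_pos[OF flow_range[OF x01]] by auto
      then show "x \<in> B" using x x01 flow_range[OF x01, of "int N"]
        by (auto simp: E_def B_def cyl_def)
    qed
  qed
  also have "measure stack B \<le> 2 * real N / ?q' ^ 3"
    unfolding B_def by (rule prob_drift)
  also have "\<dots> = 2 * of_int (?q ^ 3) / of_int (?q ^ 12)"
    by (simp only: period_Suc N[symmetric] flip: power_mult) simp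
  also have "\<dots> = 2 / of_int (?q ^ 9)"
    by (simp add: eval_nat_numeral)
  also have "\<dots> \<le> 2 / of_int ?q"
  proof (rule divide_left_mono)
    have "?q ^ 1 \<le> ?q ^ 9" using period_ge3[of k] by (intro power_increasing) simp_all
    then show "real_of_int ?q \<le> real_of_int (?q ^ 9)" by (simp only: of_int_le_iff power_one_right)
  qed simp_all
  finally show ?thesis unfolding E N .
qed

section \<open>The counterexample\<close>

lemma generator_cyls: "(\<Union>k. (\<lambda>C. pos k -` C \<inter> space stack) ` UNIV) = cyls"
proof -
  have e: "pos k -` C \<inter> space stack = cyl k C" for k C by (auto simp: cyl_def)
  show ?thesis
    unfolding e using cyl_in_cyls by (auto simp: cyls_def)
qed

lemma separable_stack: "separable_prob_space stack"
  unfolding separable_prob_space_def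
proof (intro conjI exI[of _ cyls] ballI allI impI)
  show "cyls \<subseteq> sets stack" by (auto simp: sets_stack)
  fix A and e :: real assume "A \<in> sets stack" "0 < e"
  then show "\<exists>B\<in>cyls. measure stack (sym_diff A B) < e"
  proof (rule stack.approx_by_algebra[where R = cyls, rotated -2])
    show "\<exists>B\<in>cyls. measure stack (sym_diff A B) < e" if "A \<in> cyls" "0 < e" for A and e :: real
      using that by (intro bexI[of _ A]) simp_all
    show "cyls \<subseteq> sets stack" by (auto simp: sets_stack)
  qed (simp_all add: sets_stack algebra_cyls)
qed (simp_all add: countable_cyls stack.prob_space_axioms)

lemma measure_preserving_flow: "measure_preserving_map stack (flow 1)"
  unfolding measure_preserving_map_def
  using flow_measurable[of 1] emeasure_distr[OF flow_measurable[of 1]] distr_flow[of 1] by simp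

lemma invertible_flow: "invertible_mpt stack (flow 1)"
  unfolding invertible_mpt_def
proof (intro conjI measure_preserving_flow)
  show bij: "bij_betw (flow 1) (space stack) (space stack)"
    using flow_bij by simp
  have "the_inv_into (space stack) (flow 1) x = flow (- 1) x" if "x \<in> space stack" for x
    using that bij flow_range[of x "- 1"] by (intro the_inv_into_f_eq) (auto simp: bij_betw_def flow_flow flow_0)
  then show "the_inv_into (space stack) (flow 1) \<in> measurable stack stack"
    using flow_measurable[of "- 1"] by (subst measurable_cong)
qed

lemma vimage_funpow_flow: "(flow 1 ^^ n) -` A \<inter> space stack = flow (int n) -` A \<inter> space stack"
  using funpow_flow by auto

lemma mixing_cyl:
  "(\<lambda>n. measure stack (cyl k C \<inter> ((flow 1 ^^ nat (period n ^ 3)) -` cyl k D \<inter> space stack)))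
     \<longlonglongrightarrow> measure stack (cyl k C) * measure stack (cyl k D)"
proof (rule LIM_zero_cancel, rule tendsto_rabs_zero_cancel, rule tendsto_sandwich[OF _ _ tendsto_const tendsto_over_period[of 2]])
  have "\<bar>measure stack (cyl k C \<inter> ((flow 1 ^^ nat (period n ^ 3)) -` cyl k D \<inter> space stack))
      - measure stack (cyl k C) * measure stack (cyl k D)\<bar> \<le> 2 / period n" if n: "k \<le> n" for n
  proof -
    obtain C' where C': "C' \<subseteq> {0..<period n}" "cyl k C = cyl n C'" using cyl_refine[OF n, of C] by blast
    obtain D' where D': "D' \<subseteq> {0..<period n}" "cyl k D = cyl n D'" using cyl_refine[OF n, of D] by blast
    have "int (nat (period n ^ 3)) = period n ^ 3" by simp
    then show ?thesis
      unfolding C'(2) D'(2) vimage_funpow_flow using prob_mixing[OF C'(1) D'(1)] by (simp only:)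
  qed
  then show "\<forall>\<^sub>F n in sequentially. \<bar>measure stack (cyl k C \<inter> ((flow 1 ^^ nat (period n ^ 3)) -` cyl k D \<inter> space stack))
      - measure stack (cyl k C) * measure stack (cyl k D)\<bar> \<le> 2 / period n"
    unfolding eventually_sequentially by blast
qed simp

lemma weakly_mixing_flow: "weakly_mixing stack (flow 1)"
proof (rule weakly_mixingI[where \<xi> = pos and m = "\<lambda>n. nat (period n ^ 3)"])
  show "sets stack = sigma_sets (space stack) (\<Union>k. (\<lambda>C. pos k -` C \<inter> space stack) ` UNIV)"
    unfolding generator_cyls by (simp add: sets_stack)
  show "finite (pos k ` space stack)" for k
    by (rule finite_subset[of _ "{0..<period k}"]) (use pos_range in auto)
  show "\<exists>\<phi>. \<forall>x\<in>space stack. pos k x = \<phi> (pos l x)" if "k \<le> l" for k l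
    using pos_coarsen[OF that] by simp
  have "pos k -` {c} \<inter> space stack = cyl k {c}" for k c by (auto simp: cyl_def)
  then show "(\<lambda>n. measure stack (pos k -` {c} \<inter> space stack
        \<inter> ((flow 1 ^^ nat (period n ^ 3)) -` (pos k -` {d} \<inter> space stack) \<inter> space stack)))
      \<longlonglongrightarrow> measure stack (pos k -` {c} \<inter> space stack) * measure stack (pos k -` {d} \<inter> space stack)" for k c d
    by (simp only: mixing_cyl)
qed (use distr_flow[of 1] in \<open>simp_all add: stack.prob_space_axioms flow_measurable\<close>)

lemma filterlim_period: "filterlim (\<lambda>k. nat (period k)) at_top sequentially"
proof (rule filterlim_at_top_mono[OF filterlim_ident])
  show "\<forall>\<^sub>F k in sequentially. k \<le> nat (period k)"
    using period_gt by (intro always_eventually allI) (smt (verit) nat_le_iff le_nat_iff period_nonneg)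
qed

theorem mainTheorem9:
  "\<exists>(M :: real measure) (T :: real \<Rightarrow> real) (f :: real \<Rightarrow> real).
     separable_prob_space M \<and>
     invertible_mpt M T \<and>
     weakly_mixing M T \<and>
     f \<in> borel_measurable M \<and>
     bounded (f ` space M) \<and>
     \<not> converges_in_L2 M (\<lambda>N x. (1 / real N) * (\<Sum>n = 1..N. koopman T (n * N) f x))"
proof (intro exI conjI)
  let ?A = "cyl 0 {0}"
  show "separable_prob_space stack" by (rule separable_stack)
  show "invertible_mpt stack (flow 1)" by (rule invertible_flow)
  show "weakly_mixing stack (flow 1)" by (rule weakly_mixing_flow)
  show "indicator ?A \<in> borel_measurable stack" by (intro borel_measurable_indicator cyl_sets)
  show "bounded ((indicator ?A :: real \<Rightarrow> real) ` space stack)"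
    by (rule bounded_subset[of "{0, 1}"]) (auto simp: indicator_def)
  have A: "measure stack ?A = 1 / 3"
    by (subst measure_cyl) (simp_all add: period_def)
  show "\<not> converges_in_L2 stack (\<lambda>N x. (1 / real N) * (\<Sum>n = 1..N. koopman (flow 1) (n * N) (indicator ?A) x))"
  proof (rule rigid_mixing_not_converges[where N = "\<lambda>k. nat (period k)" and m = "\<lambda>k. nat (period k ^ 3)"
        and \<epsilon> = "\<lambda>k. 2 / period k"])
    fix k n assume n: "n \<le> nat (period k)"
    obtain \<phi> where \<phi>: "\<forall>x\<in>{0..<1}. pos 0 x = \<phi> (pos k x)" using pos_coarsen[of 0 k] by blast
    have "{x \<in> space stack. ((flow 1 ^^ (n * nat (period k))) x \<in> ?A) \<noteq> (x \<in> ?A)}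
       \<subseteq> {x \<in> {0..<1}. pos k (flow (int n * period k) x) \<noteq> pos k x}"
    proof clarify
      fix x assume x: "x \<in> space stack" and ne: "((flow 1 ^^ (n * nat (period k))) x \<in> ?A) \<noteq> (x \<in> ?A)"
      have x01: "x \<in> {0..<1}" using x by simp
      have "pos k (flow (int n * period k) x) \<noteq> pos k x"
      proof
        assume "pos k (flow (int n * period k) x) = pos k x"
        then have "pos 0 (flow (int n * period k) x) = pos 0 x"
          using \<phi> x01 flow_range[OF x01, of "int n * period k"] by metis
        then show False
          using ne x01 flow_range[OF x01, of "int n * period k"] funpow_flow[OF x01, of "n * nat (period k)"]
          by (simp add: cyl_def)
      qed
      with x01 show "x \<in> {0..<1} \<and> pos k (flow (int n * period k) x) \<noteq> pos k x" by blast
    qed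
    then have "measure stack {x \<in> space stack. ((flow 1 ^^ (n * nat (period k))) x \<in> ?A) \<noteq> (x \<in> ?A)}
       \<le> measure stack {x \<in> {0..<1}. pos k (flow (int n * period k) x) \<noteq> pos k x}"
      by (intro stack.finite_measure_mono pos_flow_sets)
    also have "\<dots> \<le> 2 / period k" by (rule prob_rigid[OF n])
    finally show "measure stack {x \<in> space stack. ((flow 1 ^^ (n * nat (period k))) x \<in> ?A) \<noteq> (x \<in> ?A)} \<le> 2 / period k" .
  next
    show "(\<lambda>k. measure stack (?A \<inter> ((flow 1 ^^ nat (period k ^ 3)) -` ?A \<inter> space stack))) \<longlonglongrightarrow> (measure stack ?A)\<^sup>2"
      unfolding power2_eq_square by (rule mixing_cyl)
    show "filterlim (\<lambda>k. nat (period k ^ 3)) at_top sequentially"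
    proof (rule filterlim_at_top_mono[OF filterlim_period], intro always_eventually allI nat_mono)
      fix k
      have "period k ^ 1 \<le> period k ^ 3" using period_ge3[of k] by (intro power_increasing) simp_all
      then show "period k \<le> period k ^ 3" by simp
    qed
  qed (use distr_flow[of 1] A in \<open>simp_all add: stack.prob_space_axioms flow_measurable filterlim_period tendsto_over_period\<close>)
qed

end
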